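(* Let $P\subset\mathbb R^2$ be a compact triangle (the convex hull of three non-collinear points). For a real number $d>0$, let $r_{d\cdot P}$ be the smallest degree of a nonzero polynomial in $\mathbb R[X_1,X_2]$ vanishing on $d\cdot P\cap\mathbb Z^2$, and let $s_{d\cdot P}$ be the smallest number $u\ge0$ such that every function $d\cdot P\cap\mathbb Z^2\to\mathbb R$ can be interpolated by a polynomial in $\mathbb R[X_1,X_2]$ of degree at most $u$. Let $v_P=\lim_{d\to\infty}(r_{d\cdot P}-1)/d$ and $w_P=\lim_{d\to\infty}s_{d\cdot P}/d$ (these limits exist and are positive real numbers). Then \[ v_P\,w_P=2\operatorname{vol}(P). \]
   Context: $d\cdot P=\{d\cdot a\mid a\in P\}$. "Degree" means total degree. $\operatorname{vol}$ is area. The limits are taken over real $d\to\infty$. *)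

theory Defs
  imports "HOL-Analysis.Analysis" "HOL-Computational_Algebra.Polynomial"
begin

text \<open>
  A polynomial in \<open>\<real>[X\<^sub>1, X\<^sub>2]\<close> is represented as an element of \<open>\<real>[X\<^sub>1][X\<^sub>2]\<close>: the
  coefficient of \<open>X\<^sub>1\<^sup>i X\<^sub>2\<^sup>j\<close> in \<open>p\<close> is \<open>coeff (coeff p j) i\<close>. The zero polynomial gets total
  degree \<open>0\<close>, so it has degree at most \<open>u\<close> for every \<open>u \<ge> 0\<close>.
\<close>

definition total_degree :: "real poly poly \<Rightarrow> nat" where
  "total_degree p = Max (insert 0 {i + j | i j. coeff (coeff p j) i \<noteq> 0})"

definition eval2 :: "real poly poly \<Rightarrow> real ^ 2 \<Rightarrow> real" where
  "eval2 p x = poly (poly p [:x $ 2:]) (x $ 1)"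

definition dilate :: "real \<Rightarrow> (real ^ 2) set \<Rightarrow> (real ^ 2) set" where
  "dilate d P = (\<lambda>a. d *\<^sub>R a) ` P"

definition lattice_points :: "(real ^ 2) set \<Rightarrow> (real ^ 2) set" where
  "lattice_points P = {x \<in> P. \<forall>i. x $ i \<in> \<int>}"

text \<open>
  For bounded \<open>P\<close> the set of lattice points is finite, so both minima below are attained.
\<close>

definition r_deg :: "(real ^ 2) set \<Rightarrow> nat" where
  "r_deg P = (LEAST r. \<exists>p. p \<noteq> 0 \<and> total_degree p = r \<and> (\<forall>x\<in>lattice_points P. eval2 p x = 0))"

definition s_deg :: "(real ^ 2) set \<Rightarrow> nat" where
  "s_deg P = (LEAST u. \<forall>f :: real ^ 2 \<Rightarrow> real.
     \<exists>p. total_degree p \<le> u \<and> (\<forall>x\<in>lattice_points P. eval2 p x = f x))"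

end

(*
Write L for the set of lattice points of d * P. A function c on L is the same as a Laurent polynomial
g = sum c(a) X^a supported on L, and c is orthogonal to all polynomials of degree less than k if and
only if g vanishes to order k at (1, 1). Thus s is the largest multiplicity at (1, 1) of a nonzero g
supported on L, and r - 1 is the largest k such that the Laurent polynomials supported on L realize
all jets of order k at (1, 1).

For a Laurent polynomial f let tau(f) be the size of the smallest translate of a multiple of P that
contains its exponents and mult(f) its multiplicity at (1, 1); both are additive. If f is prime and
does not divide g, then mult(f) mult(g) <= 2 vol(P) tau(f) tau(g): compare the dimension of
f^n A + g^n B inside the polynomials supported on a large multiple of P with the codimension of its
n (mult(f) + mult(g))-jets, for n tending to infinity.

If mult(f) <= sqrt(2 vol(P)) tau(f) for all primes f, then a dimension count shows
v = w = sqrt(2 vol(P)). Otherwise fix a prime f violating this inequality, and put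
w = mult(f) / tau(f) and v = 2 vol(P) / w. Every g with mult(g) > v tau(g) is divisible by f. Hence
s <= w d, and repeated division by f bounds the dimension of the space of all g supported on L with
mult(g) >= k, for every k > v d. With this bound at k about v d, a polynomial of degree much less
than v d vanishing on L would contradict |L| ~ vol(P) d^2, because v w = 2 vol(P).
*)

theory Submission
  imports Defs "HOL-Computational_Algebra.Polynomial_Factorial"
    "HOL-Computational_Algebra.Field_as_Ring"
begin

section \<open>Linear algebra\<close>

text \<open>The link with (1, 1): the Taylor coefficients of g there are the sums of c(a) times
  products of binomials in the coordinates of a, and the products of total degree less than k form a
  basis of the polynomials of degree less than k. Two obstacles shape the rest. Exponents are
  natural numbers here, so for each d the triangle is moved by a large vector (z, z), with enough
  room to stay in the quadrant when powers of f or g are divided out. Lattice points are counted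
  only up to an error linear in the size, so only quadratic leading terms can be compared. For r
  from below: at the first order k beyond v d, the space of g has dimension at most |L| - k^2 / 2 +
  O(d), so the jet conditions are nearly independent. A polynomial of degree r <= k vanishing on L
  makes about (k - r)^2 / 2 of them redundant through its multiples, whence k - r = O(sqrt d). For r
  from above: beyond order v d every g is divisible by f, or zero if no such f exists, so jets can
  no longer be prescribed freely.\<close>

locale linear_space = vector_space scale
  for scale :: "'a::field \<Rightarrow> 'b::ab_group_add \<Rightarrow> 'b"
begin

text \<open>The space of all polynomials is infinite-dimensional, so finite dimension is required of
  each subspace separately.\<close>

definition fin_dim_subspace :: "'b set \<Rightarrow> bool" where
  "fin_dim_subspace W \<longleftrightarrow> subspace W \<and> (\<exists>F. finite F \<and> W \<subseteq> span F)"

definition functional_on :: "'b set \<Rightarrow> ('b \<Rightarrow> 'a) \<Rightarrow> bool" where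
  "functional_on W \<phi> \<longleftrightarrow>
     (\<forall>x\<in>W. \<forall>y\<in>W. \<phi> (x + y) = \<phi> x + \<phi> y) \<and> (\<forall>c. \<forall>x\<in>W. \<phi> (scale c x) = c * \<phi> x)"

lemma fin_dim_subspaceD: "fin_dim_subspace W \<Longrightarrow> subspace W"
  by (simp add: fin_dim_subspace_def)

lemma fin_dim_subspace_subset:
  "fin_dim_subspace W \<Longrightarrow> subspace U \<Longrightarrow> U \<subseteq> W \<Longrightarrow> fin_dim_subspace U"
  unfolding fin_dim_subspace_def by (meson order_trans)

lemma functional_on_subset: "functional_on W \<phi> \<Longrightarrow> U \<subseteq> W \<Longrightarrow> functional_on U \<phi>"
  unfolding functional_on_def by (meson subsetD)

lemma extend_to_basis:
  assumes W: "fin_dim_subspace W" and S: "independent S" "S \<subseteq> W"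
  obtains B where "S \<subseteq> B" "B \<subseteq> W" "independent B" "W = span B" "finite B" "card B = dim W"
proof -
  obtain B where B: "S \<subseteq> B" "B \<subseteq> W" "independent B" "W \<subseteq> span B"
    using maximal_independent_subset_extend[OF S(2,1)] by blast
  obtain F where "finite F" "W \<subseteq> span F"
    using W unfolding fin_dim_subspace_def by blast
  then have "finite B"
    using independent_span_bound[of F B] B by blast
  moreover have "W = span B"
    using B span_minimal[of B W] W unfolding fin_dim_subspace_def by blast
  ultimately show thesis
    using that[OF B(1-3)] basis_card_eq_dim[OF B(2,4,3)] by blast
qed

lemma fin_dim_basis:
  assumes W: "fin_dim_subspace W"
  obtains B where "B \<subseteq> W" "independent B" "W = span B" "finite B" "card B = dim W"
  by (rule extend_to_basis[OF W independent_empty empty_subsetI]) (rule that)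

lemma dim_mono_fin_dim:
  assumes "fin_dim_subspace W" "U \<subseteq> W"
  shows "dim U \<le> dim W"
proof -
  obtain B where "W = span B" "finite B" "card B = dim W"
    using fin_dim_basis[OF assms(1)] by blast
  then show ?thesis
    using dim_le_card[of U B] assms(2) by simp
qed

lemma subspace_kernel:
  assumes W: "subspace W" and \<phi>: "functional_on W \<phi>"
  shows "subspace {w \<in> W. \<phi> w = 0}"
proof (rule subspaceI)
  have "\<phi> (scale 0 0) = 0 * \<phi> 0"
    using \<phi> subspace_0[OF W] unfolding functional_on_def by blast
  then show "0 \<in> {w \<in> W. \<phi> w = 0}"
    using subspace_0[OF W] by simp
next
  fix x y assume "x \<in> {w \<in> W. \<phi> w = 0}" "y \<in> {w \<in> W. \<phi> w = 0}"
  then show "x + y \<in> {w \<in> W. \<phi> w = 0}"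
    using \<phi> subspace_add[OF W] by (simp add: functional_on_def)
next
  fix c x assume "x \<in> {w \<in> W. \<phi> w = 0}"
  then show "scale c x \<in> {w \<in> W. \<phi> w = 0}"
    using \<phi> subspace_scale[OF W] by (simp add: functional_on_def)
qed

lemma dim_le_dim_kernel:
  assumes W: "fin_dim_subspace W" and \<phi>: "functional_on W \<phi>"
  shows "dim W \<le> dim {w \<in> W. \<phi> w = 0} + 1"
proof (cases "\<forall>w\<in>W. \<phi> w = 0")
  case True
  then have "{w \<in> W. \<phi> w = 0} = W" by blast
  then show ?thesis by simp
next
  case False
  then obtain w0 where w0: "w0 \<in> W" "\<phi> w0 \<noteq> 0" by blast
  let ?K = "{w \<in> W. \<phi> w = 0}"
  note sW = fin_dim_subspaceD[OF W]
  have "fin_dim_subspace ?K"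
    using fin_dim_subspace_subset[OF W subspace_kernel[OF sW \<phi>]] by blast
  then obtain B where B: "?K = span B" "finite B" "card B = dim ?K"
    using fin_dim_basis by blast
  have "W \<subseteq> span (insert w0 B)"
  proof
    fix w assume w: "w \<in> W"
    define c where "c = - \<phi> w / \<phi> w0"
    have "\<phi> (w + scale c w0) = \<phi> w + c * \<phi> w0"
      using \<phi> w w0 sW unfolding functional_on_def by (simp add: subspace_scale)
    then have "\<phi> (w + scale c w0) = 0"
      using w0 by (simp add: c_def)
    moreover have "w + scale c w0 \<in> W"
      using w w0 sW by (simp add: subspace_add subspace_scale)
    ultimately have "w + scale c w0 \<in> span B"
      using B by blast
    then have 1: "w + scale c w0 \<in> span (insert w0 B)"
      using span_mono[of B "insert w0 B"] by blast
    have 2: "scale c w0 \<in> span (insert w0 B)"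
      by (simp add: span_base span_scale)
    show "w \<in> span (insert w0 B)"
      using span_diff[OF 1 2] by simp
  qed
  then have "dim W \<le> card (insert w0 B)"
    using B by (intro dim_le_card) auto
  also have "\<dots> \<le> dim ?K + 1"
    using B by (simp add: card_insert_if)
  finally show ?thesis .
qed

lemma subspace_common_kernel:
  assumes W: "subspace W" and "\<And>\<phi>. \<phi> \<in> \<Phi> \<Longrightarrow> functional_on W \<phi>"
  shows "subspace {w \<in> W. \<forall>\<phi>\<in>\<Phi>. \<phi> w = 0}"
proof -
  have "{w \<in> W. \<forall>\<phi>\<in>\<Phi>. \<phi> w = 0} = W \<inter> (\<Inter>\<phi>\<in>\<Phi>. {w \<in> W. \<phi> w = 0})" by blast
  also have "subspace \<dots>"
    using assms subspace_kernel by (intro subspace_inter subspace_Inter) auto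
  finally show ?thesis .
qed

lemma dim_le_dim_common_kernel:
  assumes W: "fin_dim_subspace W" and "finite \<Phi>" "\<And>\<phi>. \<phi> \<in> \<Phi> \<Longrightarrow> functional_on W \<phi>"
  shows "dim W \<le> dim {w \<in> W. \<forall>\<phi>\<in>\<Phi>. \<phi> w = 0} + card \<Phi>"
  using assms(2,3)
proof (induction \<Phi> rule: finite_induct)
  case empty
  then show ?case by simp
next
  case (insert \<phi> \<Phi>)
  let ?K = "{w \<in> W. \<forall>\<phi>\<in>\<Phi>. \<phi> w = 0}"
  have "subspace ?K"
    using insert.prems by (intro subspace_common_kernel fin_dim_subspaceD[OF W]) simp
  then have K: "fin_dim_subspace ?K"
    by (rule fin_dim_subspace_subset[OF W]) auto
  have "dim ?K \<le> dim {w \<in> ?K. \<phi> w = 0} + 1"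
    using insert.prems functional_on_subset[of W \<phi> ?K] by (intro dim_le_dim_kernel[OF K]) auto
  moreover have "{w \<in> ?K. \<phi> w = 0} = {w \<in> W. \<forall>\<psi>\<in>insert \<phi> \<Phi>. \<psi> w = 0}" by auto
  moreover have "dim W \<le> dim ?K + card \<Phi>"
    using insert by simp
  ultimately show ?case
    using insert.hyps by simp
qed

text \<open>Extend a basis of \<open>U\<close> to one of \<open>W\<close>: the coordinates along the
  added vectors are the required functionals.\<close>

lemma subspace_as_common_kernel:
  assumes W: "fin_dim_subspace W" and U: "subspace U" "U \<subseteq> W"
  obtains \<Phi> where "finite \<Phi>" "card \<Phi> + dim U \<le> dim W" "\<And>\<phi>. \<phi> \<in> \<Phi> \<Longrightarrow> functional_on W \<phi>"
    "{w \<in> W. \<forall>\<phi>\<in>\<Phi>. \<phi> w = 0} \<subseteq> U"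
proof -
  obtain B0 where B0: "B0 \<subseteq> U" "independent B0" "U = span B0" "finite B0" "card B0 = dim U"
    using fin_dim_basis[OF fin_dim_subspace_subset[OF W U]] by blast
  then obtain B where B: "B0 \<subseteq> B" "B \<subseteq> W" "independent B" "W = span B" "finite B" "card B = dim W"
    using extend_to_basis[OF W, of B0] U by blast
  let ?\<phi> = "\<lambda>b w. representation B w b"
  show thesis
  proof
    show "finite (?\<phi> ` (B - B0))" using B by simp
    have "card (?\<phi> ` (B - B0)) \<le> card (B - B0)"
      using B by (intro card_image_le) auto
    also have "\<dots> = card B - card B0"
      using B B0 by (intro card_Diff_subset) auto
    finally show "card (?\<phi> ` (B - B0)) + dim U \<le> dim W"
      using B B0 card_mono[of B B0] by simp
    show "functional_on W \<phi>" if "\<phi> \<in> ?\<phi> ` (B - B0)" for \<phi>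
      using that B unfolding functional_on_def
      by (auto simp: representation_add representation_scale)
    show "{w \<in> W. \<forall>\<phi>\<in>?\<phi> ` (B - B0). \<phi> w = 0} \<subseteq> U"
    proof
      fix w assume "w \<in> {w \<in> W. \<forall>\<phi>\<in>?\<phi> ` (B - B0). \<phi> w = 0}"
      then have w: "w \<in> span B" "\<And>b. b \<in> B - B0 \<Longrightarrow> representation B w b = 0"
        using B by auto
      have "w = (\<Sum>b\<in>B. scale (representation B w b) b)"
        using sum_representation_eq[OF B(3) w(1) B(5)] by simp
      also have "\<dots> = (\<Sum>b\<in>B0. scale (representation B w b) b)"
        using B w by (intro sum.mono_neutral_right) auto
      also have "\<dots> \<in> span B0"
        by (intro span_sum span_scale span_base)
      finally show "w \<in> U" using B0 by simp
    qed
  qed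
qed

text \<open>Membership in \<open>U2\<close> can be forced by at most \<open>dim W - dim U2\<close>
  equations, and each of them lowers the dimension of \<open>U1\<close> by at most one.\<close>

lemma dim_add_le_dim_Int:
  assumes W: "fin_dim_subspace W" and U: "subspace U1" "U1 \<subseteq> W" "subspace U2" "U2 \<subseteq> W"
  shows "dim U1 + dim U2 \<le> dim W + dim (U1 \<inter> U2)"
proof -
  obtain \<Phi> where \<Phi>: "finite \<Phi>" "card \<Phi> + dim U2 \<le> dim W" "\<And>\<phi>. \<phi> \<in> \<Phi> \<Longrightarrow> functional_on W \<phi>"
    "{w \<in> W. \<forall>\<phi>\<in>\<Phi>. \<phi> w = 0} \<subseteq> U2"
    using subspace_as_common_kernel[OF W U(3,4)] by blast
  have fU1: "fin_dim_subspace U1"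
    using fin_dim_subspace_subset[OF W U(1,2)] .
  have "dim U1 \<le> dim {w \<in> U1. \<forall>\<phi>\<in>\<Phi>. \<phi> w = 0} + card \<Phi>"
    using \<Phi>(1,3) functional_on_subset[OF _ U(2)] by (intro dim_le_dim_common_kernel[OF fU1]) auto
  also have "dim {w \<in> U1. \<forall>\<phi>\<in>\<Phi>. \<phi> w = 0} \<le> dim (U1 \<inter> U2)"
    using \<Phi>(4) U fin_dim_subspace_subset[OF fU1 subspace_inter[OF U(1,3)]]
    by (intro dim_mono_fin_dim) auto
  finally show ?thesis using \<Phi>(2) by simp
qed

text \<open>Half of \<open>row rank = column rank\<close>; the other half arises by exchanging the two sides.\<close>

lemma dim_add_le_dim_annihilator:
  assumes V: "fin_dim_subspace V" and Q: "fin_dim_subspace Q"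
    and Q': "subspace Q'" "Q' \<subseteq> Q"
    and \<beta>: "\<And>q. q \<in> Q \<Longrightarrow> functional_on V (\<lambda>v. \<beta> q v)"
      "\<And>v. v \<in> V \<Longrightarrow> functional_on Q (\<lambda>q. \<beta> q v)"
    and zero: "\<And>q v. q \<in> Q' \<Longrightarrow> v \<in> V \<Longrightarrow> \<beta> q v = 0"
  shows "dim V + dim Q' \<le> dim {v \<in> V. \<forall>q\<in>Q. \<beta> q v = 0} + dim Q"
proof -
  obtain B0 where B0: "B0 \<subseteq> Q'" "independent B0" "Q' = span B0" "finite B0" "card B0 = dim Q'"
    using fin_dim_basis[OF fin_dim_subspace_subset[OF Q Q']] by blast
  then obtain B where B: "B0 \<subseteq> B" "B \<subseteq> Q" "independent B" "Q = span B" "finite B" "card B = dim Q"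
    using extend_to_basis[OF Q, of B0] Q' by blast
  \<comment> \<open>Elements of \<open>Q'\<close> pair to zero with all of \<open>V\<close>, so only
    the basis vectors outside \<open>Q'\<close> impose conditions.\<close>
  have "dim V \<le> dim {v \<in> V. \<forall>\<phi>\<in>\<beta> ` (B - B0). \<phi> v = 0} + card (\<beta> ` (B - B0))"
    using B \<beta>(1) by (intro dim_le_dim_common_kernel[OF V]) auto
  moreover have "card (\<beta> ` (B - B0)) + dim Q' \<le> dim Q"
    using card_image_le[of "B - B0" \<beta>] card_Diff_subset[of B0 B] card_mono[of B B0] B B0 by simp
  moreover have "{v \<in> V. \<forall>\<phi>\<in>\<beta> ` (B - B0). \<phi> v = 0} = {v \<in> V. \<forall>q\<in>Q. \<beta> q v = 0}"
  proof (intro equalityI subsetI)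
    fix v assume "v \<in> {v \<in> V. \<forall>\<phi>\<in>\<beta> ` (B - B0). \<phi> v = 0}"
    then have v: "v \<in> V" "\<And>b. b \<in> B \<Longrightarrow> \<beta> b v = 0"
      using zero B0 by blast+
    have "Q \<subseteq> {q \<in> Q. \<beta> q v = 0}"
      using B v span_minimal[OF _ subspace_kernel[OF fin_dim_subspaceD[OF Q] \<beta>(2)[OF v(1)]], of B]
      by auto
    then show "v \<in> {v \<in> V. \<forall>q\<in>Q. \<beta> q v = 0}"
      using v by blast
  qed (use B in auto)
  ultimately show ?thesis by simp
qed

lemma dim_injective_image:
  assumes W: "fin_dim_subspace W" and f: "Vector_Spaces.linear scale scale f" and inj: "inj_on f W"
  shows "dim (f ` W) = dim W" "fin_dim_subspace (f ` W)"
proof -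
  interpret f: Vector_Spaces.linear scale scale f by (rule f)
  obtain B where B: "B \<subseteq> W" "independent B" "W = span B" "finite B" "card B = dim W"
    using fin_dim_basis[OF W] by blast
  have img: "f ` W = span (f ` B)"
    using B f.span_image by blast
  have "independent (f ` B)"
    using f.independent_injective_image[of B] B inj by simp
  then have "dim (f ` W) = card (f ` B)"
    using img dim_span_eq_card_independent by simp
  then show "dim (f ` W) = dim W"
    using card_image[OF inj_on_subset[OF inj B(1)]] B by simp
  show "fin_dim_subspace (f ` W)"
    unfolding fin_dim_subspace_def using img B by auto
qed

end

text \<open>Induction on the rows. A new row annihilated by every solution of the old homogeneous
  system is a combination of the old rows and changes nothing; otherwise some solution
  \<open>x0\<close> detects it and serves as a pivot.\<close>

lemma fredholm_alternative:
  fixes A :: "'k \<Rightarrow> 'i \<Rightarrow> real" and y :: "'i \<Rightarrow> real"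
  assumes "finite I" "finite K"
  shows "(\<exists>c. \<forall>i\<in>I. y i = (\<Sum>k\<in>K. c k * A k i)) \<or>
    (\<exists>x. (\<forall>k\<in>K. (\<Sum>i\<in>I. x i * A k i) = 0) \<and> (\<Sum>i\<in>I. x i * y i) \<noteq> 0)"
  using assms(2)
proof (induction K arbitrary: y rule: finite_induct)
  case empty
  show ?case
  proof (cases "\<forall>i\<in>I. y i = 0")
    case False
    then have "(\<Sum>i\<in>I. y i * y i) \<noteq> 0"
      using sum_nonneg_eq_0_iff[OF assms(1), of "\<lambda>i. y i * y i"] by auto
    then show ?thesis by (intro disjI2 exI[of _ y]) simp
  qed auto
next
  case (insert k0 K)
  show ?case
  proof (cases "\<exists>x. (\<forall>k\<in>K. (\<Sum>i\<in>I. x i * A k i) = 0) \<and> (\<Sum>i\<in>I. x i * A k0 i) \<noteq> 0")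
    case False
    then obtain c0 where c0: "\<forall>i\<in>I. A k0 i = (\<Sum>k\<in>K. c0 k * A k i)"
      using insert.IH[of "A k0"] by blast
    from insert.IH[of y] show ?thesis
    proof (elim disjE exE)
      fix c assume c: "\<forall>i\<in>I. y i = (\<Sum>k\<in>K. c k * A k i)"
      have "\<forall>i\<in>I. y i = (\<Sum>k\<in>insert k0 K. (c(k0 := 0)) k * A k i)"
        using c insert.hyps by (auto intro!: sum.cong)
      then show ?thesis by blast
    next
      fix x assume x: "(\<forall>k\<in>K. (\<Sum>i\<in>I. x i * A k i) = 0) \<and> (\<Sum>i\<in>I. x i * y i) \<noteq> 0"
      then have "(\<Sum>i\<in>I. x i * A k0 i) = 0"
        using False by blast
      then show ?thesis using x by blast
    qed
  next
    case True
    then obtain x0 where x0: "\<forall>k\<in>K. (\<Sum>i\<in>I. x0 i * A k i) = 0" "(\<Sum>i\<in>I. x0 i * A k0 i) \<noteq> 0"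
      by blast
    define s where "s = (\<Sum>i\<in>I. x0 i * A k0 i)"
    \<comment> \<open>Pairing with \<open>x0\<close> kills the old rows, so \<open>r\<close> is the
      only possible coefficient of the row \<open>k0\<close> in \<open>y\<close>.\<close>
    define r where "r = (\<Sum>i\<in>I. x0 i * y i) / s"
    from insert.IH[of "\<lambda>i. y i - r * A k0 i"] show ?thesis
    proof (elim disjE exE)
      fix c assume c: "\<forall>i\<in>I. y i - r * A k0 i = (\<Sum>k\<in>K. c k * A k i)"
      have "\<forall>i\<in>I. y i = (\<Sum>k\<in>insert k0 K. (c(k0 := r)) k * A k i)"
      proof
        fix i assume "i \<in> I"
        have "(\<Sum>k\<in>insert k0 K. (c(k0 := r)) k * A k i) = r * A k0 i + (\<Sum>k\<in>K. (c(k0 := r)) k * A k i)"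
          using insert.hyps by simp
        also have "(\<Sum>k\<in>K. (c(k0 := r)) k * A k i) = (\<Sum>k\<in>K. c k * A k i)"
          using insert.hyps by (intro sum.cong) auto
        finally show "y i = (\<Sum>k\<in>insert k0 K. (c(k0 := r)) k * A k i)"
          using c \<open>i \<in> I\<close> by (metis add.commute diff_add_cancel)
      qed
      then show ?thesis by blast
    next
      fix x1 assume x1: "(\<forall>k\<in>K. (\<Sum>i\<in>I. x1 i * A k i) = 0) \<and>
        (\<Sum>i\<in>I. x1 i * (y i - r * A k0 i)) \<noteq> 0"
      define q where "q = (\<Sum>i\<in>I. x1 i * A k0 i) / s"
      have lin: "(\<Sum>i\<in>I. (x1 i - q * x0 i) * z i) = (\<Sum>i\<in>I. x1 i * z i) - q * (\<Sum>i\<in>I. x0 i * z i)"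
        for z by (simp add: sum_subtractf sum_distrib_left algebra_simps)
      have "(\<Sum>i\<in>I. (x1 i - q * x0 i) * A k i) = 0" if "k \<in> insert k0 K" for k
      proof (cases "k = k0")
        case True
        have "(\<Sum>i\<in>I. x1 i * A k0 i) = q * s"
          using x0(2) by (simp add: q_def s_def)
        then show ?thesis unfolding lin True by (simp add: s_def)
      next
        case False
        then show ?thesis unfolding lin using that x0 x1 by simp
      qed
      moreover have "(\<Sum>i\<in>I. (x1 i - q * x0 i) * y i) = (\<Sum>i\<in>I. x1 i * (y i - r * A k0 i))"
      proof -
        have "(\<Sum>i\<in>I. x1 i * (y i - r * A k0 i)) = (\<Sum>i\<in>I. x1 i * y i) - r * (\<Sum>i\<in>I. x1 i * A k0 i)"
          by (simp add: sum_subtractf sum_distrib_left algebra_simps)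
        also have "r * (\<Sum>i\<in>I. x1 i * A k0 i) = q * (\<Sum>i\<in>I. x0 i * y i)"
          by (simp add: q_def r_def)
        finally show ?thesis unfolding lin by simp
      qed
      ultimately show ?thesis using x1
        by (intro disjI2 exI[of _ "\<lambda>i. x1 i - q * x0 i"]) simp
    qed
  qed
qed

section \<open>Weights and multiplicities of bivariate polynomials\<close>

definition coeff2 :: "real poly poly \<Rightarrow> nat \<times> nat \<Rightarrow> real" where
  "coeff2 p a = coeff (coeff p (snd a)) (fst a)"

definition supp :: "real poly poly \<Rightarrow> (nat \<times> nat) set" where
  "supp p = {a. coeff2 p a \<noteq> 0}"

lemma coeff2_0 [simp]: "coeff2 0 a = 0"
  and coeff2_add [simp]: "coeff2 (p + q) a = coeff2 p a + coeff2 q a"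
  and coeff2_scale [simp]: "coeff2 (smult [:c:] p) a = c * coeff2 p a"
  by (simp_all add: coeff2_def)

lemma coeff2_sum: "coeff2 (sum f A) a = (\<Sum>x\<in>A. coeff2 (f x) a)"
  by (simp add: coeff2_def coeff_sum)

lemma coeff2_eqI: "(\<And>a. coeff2 p a = coeff2 q a) \<Longrightarrow> p = q"
  unfolding coeff2_def by (intro poly_eqI) (metis fst_conv snd_conv)

lemma coeff2_monom: "coeff2 (monom (monom c (fst a)) (snd a)) b = (if a = b then c else 0)"
  by (auto simp: coeff2_def coeff_monom prod_eq_iff)

lemma coeff2_eq_0: "a \<notin> supp p \<Longrightarrow> coeff2 p a = 0"
  by (simp add: supp_def)

lemma supp_subset_degrees: "supp p \<subseteq> {..Max ((\<lambda>j. degree (coeff p j)) ` {..degree p})} \<times> {..degree p}"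
proof (intro subrelI)
  fix i j assume "(i, j) \<in> supp p"
  then have nz: "coeff (coeff p j) i \<noteq> 0" by (simp add: supp_def coeff2_def)
  then have j: "j \<le> degree p" by (intro le_degree) auto
  have "i \<le> degree (coeff p j)" using nz by (rule le_degree)
  also have "\<dots> \<le> Max ((\<lambda>j. degree (coeff p j)) ` {..degree p})"
    using j by (intro Max_ge) auto
  finally show "(i, j) \<in> {..Max ((\<lambda>j. degree (coeff p j)) ` {..degree p})} \<times> {..degree p}"
    using j by simp
qed

lemma finite_supp [simp]: "finite (supp p)"
  by (rule finite_subset[OF supp_subset_degrees]) auto

lemma supp_eq_empty_iff [simp]: "supp p = {} \<longleftrightarrow> p = 0"
  using coeff2_eqI[of p 0] by (auto simp: supp_def)

lemma coeff2_mult: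
  "coeff2 (p * q) a = (\<Sum>b\<in>{..fst a} \<times> {..snd a}. coeff2 p b * coeff2 q (a - b))"
proof -
  have "coeff2 (p * q) a = (\<Sum>j\<le>snd a. \<Sum>i\<le>fst a. coeff2 p (i, j) * coeff2 q (a - (i, j)))"
    by (simp add: coeff2_def coeff_mult coeff_sum)
  also have "\<dots> = (\<Sum>i\<le>fst a. \<Sum>j\<le>snd a. coeff2 p (i, j) * coeff2 q (a - (i, j)))"
    by (rule sum.swap)
  also have "\<dots> = (\<Sum>b\<in>{..fst a} \<times> {..snd a}. coeff2 p b * coeff2 q (a - b))"
    by (simp add: sum.cartesian_product case_prod_unfold)
  finally show ?thesis .
qed

lemma supp_multE:
  assumes "a \<in> supp (p * q)"
  obtains b c where "b \<in> supp p" "c \<in> supp q" "a = b + c"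
proof -
  have "(\<Sum>b\<in>{..fst a} \<times> {..snd a}. coeff2 p b * coeff2 q (a - b)) \<noteq> 0"
    using assms by (simp add: supp_def coeff2_mult)
  then obtain b where "b \<in> {..fst a} \<times> {..snd a}" "coeff2 p b * coeff2 q (a - b) \<noteq> 0"
    by (meson sum.not_neutral_contains_not_neutral)
  then show thesis
    by (intro that[of b "a - b"]) (auto simp: supp_def prod_eq_iff)
qed

text \<open>A monomial valuation with arbitrary ordered values: with \<open>deg\<close>, after (1,
  1) is moved to the origin, it gives the multiplicity, and with the three edge forms the smallest
  enclosing triangle. At \<open>p = 0\<close> it is the minimum of the empty set and carries no
  meaning.\<close>

definition weight :: "(nat \<times> nat \<Rightarrow> 'w::linordered_cancel_ab_semigroup_add) \<Rightarrow> real poly poly \<Rightarrow> 'w" where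
  "weight L p = Min (L ` supp p)"

lemma weight_le: "a \<in> supp p \<Longrightarrow> weight L p \<le> L a"
  unfolding weight_def by (intro Min_le) auto

lemma weight_attained:
  assumes "p \<noteq> 0"
  obtains a where "a \<in> supp p" "L a = weight L p"
proof -
  have "weight L p \<in> L ` supp p"
    unfolding weight_def using assms by (intro Min_in) auto
  then show thesis using that by force
qed

lemma weight_ge_iff: "p \<noteq> 0 \<Longrightarrow> w \<le> weight L p \<longleftrightarrow> (\<forall>a\<in>supp p. w \<le> L a)"
  unfolding weight_def by (subst Min_ge_iff) auto

text \<open>Ties in \<open>L\<close> are broken lexicographically, so that the initial monomials of two polynomials
  multiply to a monomial occurring in no other way in the product.\<close>

lemma weight_attained_lex:
  assumes "p \<noteq> 0"
  obtains a where "a \<in> supp p" "L a = weight L p"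
    "\<And>b. b \<in> supp p \<Longrightarrow> L b = weight L p \<Longrightarrow> fst a \<le> fst b"
    "\<And>b. b \<in> supp p \<Longrightarrow> L b = weight L p \<Longrightarrow> fst b = fst a \<Longrightarrow> snd a \<le> snd b"
proof -
  let ?S = "{a \<in> supp p. L a = weight L p}"
  obtain a0 where "a0 \<in> ?S" using weight_attained[OF assms, of L] by blast
  then obtain a1 where a1: "a1 \<in> ?S" "\<And>b. b \<in> ?S \<Longrightarrow> fst a1 \<le> fst b"
    using ex_has_least_nat[of "\<lambda>a. a \<in> ?S" a0 fst] by blast
  then obtain a where a: "a \<in> ?S \<and> fst a = fst a1" "\<And>b. b \<in> ?S \<Longrightarrow> fst b = fst a1 \<Longrightarrow> snd a \<le> snd b"
    using ex_has_least_nat[of "\<lambda>a. a \<in> ?S \<and> fst a = fst a1" a1 snd] by blast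
  show thesis
    by (rule that[of a]) (use a a1 in auto)
qed

lemma weight_mult:
  assumes L: "\<And>a b. L (a + b) = L a + L b" and "p \<noteq> 0" "q \<noteq> 0"
  shows "weight L (p * q) = weight L p + weight L q"
proof (rule antisym)
  have "p * q \<noteq> 0" using assms by simp
  then show "weight L p + weight L q \<le> weight L (p * q)"
    by (metis L add_mono supp_multE weight_attained weight_le)
  obtain a where a: "a \<in> supp p" "L a = weight L p"
    "\<And>b. b \<in> supp p \<Longrightarrow> L b = weight L p \<Longrightarrow> fst a \<le> fst b"
    "\<And>b. b \<in> supp p \<Longrightarrow> L b = weight L p \<Longrightarrow> fst b = fst a \<Longrightarrow> snd a \<le> snd b"
    using weight_attained_lex[OF assms(2), of L] by metis
  obtain c where c: "c \<in> supp q" "L c = weight L q"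
    "\<And>b. b \<in> supp q \<Longrightarrow> L b = weight L q \<Longrightarrow> fst c \<le> fst b"
    "\<And>b. b \<in> supp q \<Longrightarrow> L b = weight L q \<Longrightarrow> fst b = fst c \<Longrightarrow> snd c \<le> snd b"
    using weight_attained_lex[OF assms(3), of L] by metis
  have unique: "b = a" if b: "b \<in> supp p" "d \<in> supp q" "b + d = a + c" for b d
  proof -
    have "L b + L d = L a + L c" using b(3) L by metis
    moreover have "L a \<le> L b" "L c \<le> L d"
      using b a c by (auto simp: weight_le)
    ultimately have "L b = L a" "L d = L c"
      by (metis add_less_le_mono add_le_less_mono order.order_iff_strict less_irrefl)+
    then have "fst a \<le> fst b" "fst b = fst a \<Longrightarrow> snd a \<le> snd b"
      "fst c \<le> fst d" "fst d = fst c \<Longrightarrow> snd c \<le> snd d"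
      using a c b by auto
    moreover have "fst b + fst d = fst a + fst c" "snd b + snd d = snd a + snd c"
      using b(3) by (metis fst_add, metis snd_add)
    ultimately show ?thesis by (simp add: prod_eq_iff)
  qed
  have "coeff2 (p * q) (a + c) = (\<Sum>b\<in>{a}. coeff2 p b * coeff2 q (a + c - b))"
    unfolding coeff2_mult
  proof (rule sum.mono_neutral_right)
    show "\<forall>b\<in>{..fst (a + c)} \<times> {..snd (a + c)} - {a}. coeff2 p b * coeff2 q (a + c - b) = 0"
    proof
      fix b assume b: "b \<in> {..fst (a + c)} \<times> {..snd (a + c)} - {a}"
      have "b + (a + c - b) = a + c" using b by (auto simp: prod_eq_iff)
      then have "b \<notin> supp p \<or> a + c - b \<notin> supp q" using unique b by blast
      then show "coeff2 p b * coeff2 q (a + c - b) = 0" by (auto simp: coeff2_eq_0)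
    qed
  qed (auto simp: mem_Times_iff)
  then have "a + c \<in> supp (p * q)"
    using a c by (simp add: supp_def prod_eq_iff)
  then show "weight L (p * q) \<le> weight L p + weight L q"
    using weight_le[of "a + c" "p * q" L] L a c by simp
qed

lemma supp_1: "supp 1 = {0}"
  by (auto simp: supp_def coeff2_def prod_eq_iff split: if_splits)

lemma weight_1: "weight L 1 = L 0"
  by (simp add: weight_def supp_1)

section \<open>Taylor expansion and multiplicity at (1, 1)\<close>

definition shift :: "real poly poly \<Rightarrow> real poly poly" where
  "shift p = pcompose (map_poly (\<lambda>q. pcompose q [:1, 1:]) p) [:1, 1:]"

lemma shift_mult: "shift (p * q) = shift p * shift q"
proof -
  have "map_poly (\<lambda>q. pcompose q [:1, 1:]) (p * q) =
    map_poly (\<lambda>q. pcompose q [:1, 1:]) p * map_poly (\<lambda>q. pcompose q [:1, 1::real:]) q"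
    by (intro poly_eqI) (simp add: coeff_map_poly coeff_mult pcompose_sum pcompose_mult)
  then show ?thesis by (simp add: shift_def pcompose_mult)
qed

lemma pcompose_one_plus_eq_0_iff [simp]:
  fixes q :: "'a::idom poly"
  shows "pcompose q [:1, 1:] = 0 \<longleftrightarrow> q = 0"
  by (rule pcompose_eq_0_iff) simp

lemma shift_eq_0_iff [simp]: "shift p = 0 \<longleftrightarrow> p = 0"
  unfolding shift_def by (simp add: map_poly_eq_0_iff)

lemma shift_1 [simp]: "shift 1 = 1"
  by (simp add: shift_def pcompose_1)

lemma coeff_pcompose_one_plus:
  fixes p :: "'a::comm_ring_1 poly"
  assumes "degree p \<le> n"
  shows "coeff (pcompose p [:1, 1:]) k = (\<Sum>i\<le>n. of_nat (i choose k) * coeff p i)"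
proof -
  have deg: "degree (map_poly (\<lambda>x. [:x:]) p) = degree p"
    by (cases "p = 0") (auto intro: map_poly_degree_eq)
  have "pcompose p [:1, 1:] = (\<Sum>i\<le>degree p. smult (coeff p i) ([:1, 1:] ^ i))"
    by (simp add: pcompose_altdef poly_altdef deg coeff_map_poly)
  also have "coeff \<dots> k = (\<Sum>i\<le>degree p. of_nat (i choose k) * coeff p i)"
  proof -
    have "coeff ([:1, 1:] ^ i) k = (of_nat (i choose k) :: 'a)" for i
    proof (cases "k \<le> i")
      case True
      then show ?thesis by (simp add: coeff_linear_poly_power)
    next
      case False
      have "degree ([:1, 1:] ^ i :: 'a poly) \<le> 1 * i"
        by (rule order_trans[OF degree_power_le]) simp
      then show ?thesis using False by (simp add: coeff_eq_0 binomial_eq_0)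
    qed
    then show ?thesis by (simp add: coeff_sum mult.commute)
  qed
  also have "\<dots> = (\<Sum>i\<le>n. of_nat (i choose k) * coeff p i)"
    using assms by (intro sum.mono_neutral_left) (auto simp: coeff_eq_0)
  finally show ?thesis .
qed

text \<open>By the binomial theorem each Taylor coefficient at (1, 1) is a sum over the exponents of
  \<open>p\<close>, weighted by a polynomial of degree \<open>deg a\<close> in the exponent. The
  whole duality rests on this formula.\<close>

lemma coeff2_shift:
  "coeff2 (shift p) a =
    (\<Sum>b\<in>supp p. coeff2 p b * real ((fst b choose fst a) * (snd b choose snd a)))"
proof -
  define n where "n = Max ((\<lambda>j. degree (coeff p j)) ` {..degree p})"
  have n: "degree (coeff p j) \<le> n" if "j \<le> degree p" for j
    unfolding n_def using that by (intro Max_ge) auto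
  let ?T = "\<lambda>q. pcompose q [:1, 1::real:]"
  have deg: "degree (map_poly ?T p) \<le> degree p"
    by (rule map_poly_degree_leq)
  have "coeff2 (shift p) a = (\<Sum>j\<le>degree p. real (j choose snd a) * coeff (?T (coeff p j)) (fst a))"
    unfolding coeff2_def shift_def coeff_pcompose_one_plus[OF deg]
    by (simp add: coeff_sum coeff_map_poly of_nat_poly)
  also have "\<dots> = (\<Sum>j\<le>degree p. \<Sum>i\<le>n. real (j choose snd a) * (real (i choose fst a) * coeff2 p (i, j)))"
    by (intro sum.cong refl) (simp add: coeff_pcompose_one_plus[OF n] sum_distrib_left coeff2_def)
  also have "\<dots> = (\<Sum>i\<le>n. \<Sum>j\<le>degree p. real (j choose snd a) * (real (i choose fst a) * coeff2 p (i, j)))"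
    by (rule sum.swap)
  also have "\<dots> = (\<Sum>b\<in>{..n} \<times> {..degree p}. coeff2 p b * real ((fst b choose fst a) * (snd b choose snd a)))"
    by (simp add: sum.cartesian_product case_prod_unfold mult_ac)
  also have "\<dots> = (\<Sum>b\<in>supp p. coeff2 p b * real ((fst b choose fst a) * (snd b choose snd a)))"
    using supp_subset_degrees[of p] unfolding n_def
    by (intro sum.mono_neutral_right) (auto simp: supp_def)
  finally show ?thesis .
qed

lemma coeff2_shift_superset:
  assumes "finite E" "supp p \<subseteq> E"
  shows "coeff2 (shift p) a =
    (\<Sum>b\<in>E. coeff2 p b * real ((fst b choose fst a) * (snd b choose snd a)))"
  unfolding coeff2_shift using assms by (intro sum.mono_neutral_left) (auto simp: supp_def)

lemma shift_add: "shift (p + q) = shift p + shift q"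
proof -
  have "map_poly (\<lambda>q. pcompose q [:1, 1:]) (p + q) =
    map_poly (\<lambda>q. pcompose q [:1, 1:]) p + map_poly (\<lambda>q. pcompose q [:1, 1::real:]) q"
    by (intro poly_eqI) (simp add: coeff_map_poly pcompose_add)
  then show ?thesis by (simp add: shift_def pcompose_add)
qed

lemma shift_scale: "shift (smult [:c:] p) = smult [:c:] (shift p)"
proof -
  have "shift [:[:c:]:] = [:[:c:]:]"
    by (simp add: shift_def map_poly_pCons)
  then show ?thesis
    using shift_mult[of "[:[:c:]:]" p] by simp
qed

definition deg :: "nat \<times> nat \<Rightarrow> nat" where "deg a = fst a + snd a"

lemma deg_add: "deg (a + b) = deg a + deg b"
  by (simp add: deg_def)

definition mult_at_1 :: "real poly poly \<Rightarrow> nat" where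
  "mult_at_1 p = weight deg (shift p)"

text \<open>Stated by coefficients and not as \<open>k \<le> mult_at_1 p\<close>, so that
  \<open>p = 0\<close> is included and the condition is linear in \<open>p\<close>.\<close>

definition vanishes_to :: "nat \<Rightarrow> real poly poly \<Rightarrow> bool" where
  "vanishes_to k p \<longleftrightarrow> (\<forall>a. deg a < k \<longrightarrow> coeff2 (shift p) a = 0)"

lemma vanishes_to_iff: "p \<noteq> 0 \<Longrightarrow> vanishes_to k p \<longleftrightarrow> k \<le> mult_at_1 p"
  unfolding vanishes_to_def mult_at_1_def
  by (subst weight_ge_iff) (simp, simp add: supp_def, meson not_less)

lemma vanishes_to_0 [simp]: "vanishes_to k 0"
  by (simp add: vanishes_to_def iffD2[OF shift_eq_0_iff])

lemma vanishes_to_mono: "vanishes_to k p \<Longrightarrow> l \<le> k \<Longrightarrow> vanishes_to l p"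
  by (simp add: vanishes_to_def)

lemma vanishes_to_zero [simp]: "vanishes_to 0 p"
  by (simp add: vanishes_to_def)

lemma mult_at_1_mult:
  assumes "p \<noteq> 0" "q \<noteq> 0"
  shows "mult_at_1 (p * q) = mult_at_1 p + mult_at_1 q"
  unfolding mult_at_1_def shift_mult using assms by (intro weight_mult deg_add) auto

lemma mult_at_1_1 [simp]: "mult_at_1 1 = 0"
  by (simp add: mult_at_1_def weight_1 deg_def)

lemma mult_at_1_power: "p \<noteq> 0 \<Longrightarrow> mult_at_1 (p ^ n) = n * mult_at_1 p"
  by (induction n) (simp_all add: mult_at_1_mult)

lemma vanishes_to_mult: "vanishes_to k p \<Longrightarrow> vanishes_to l q \<Longrightarrow> vanishes_to (k + l) (p * q)"
  by (cases "p = 0 \<or> q = 0") (auto simp: vanishes_to_iff mult_at_1_mult)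

section \<open>Dimensions of spaces of polynomials with prescribed vanishing\<close>

interpretation poly2: linear_space "\<lambda>c (p::real poly poly). smult [:c:] p"
  by unfold_locales (auto intro!: coeff2_eqI simp: algebra_simps)

lemma shift_0 [simp]: "shift 0 = 0"
  by simp

definition polys_on :: "(nat \<times> nat) set \<Rightarrow> real poly poly set" where
  "polys_on E = {p. supp p \<subseteq> E}"

definition mono2 :: "nat \<times> nat \<Rightarrow> real poly poly" where
  "mono2 a = monom (monom 1 (fst a)) (snd a)"

lemma coeff2_mono2: "coeff2 (mono2 a) b = (if a = b then 1 else 0)"
  unfolding mono2_def by (rule coeff2_monom)

lemma supp_mono2 [simp]: "supp (mono2 a) = {a}"
  by (auto simp: supp_def coeff2_mono2)

lemma mono2_nz [simp]: "mono2 a \<noteq> 0"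
  by (metis supp_mono2 supp_eq_empty_iff insert_not_empty)

lemma polys_on_iff: "p \<in> polys_on E \<longleftrightarrow> (\<forall>a. a \<notin> E \<longrightarrow> coeff2 p a = 0)"
  by (auto simp: polys_on_def supp_def)

lemma subspace_polys_on: "poly2.subspace (polys_on E)"
  by (rule poly2.subspaceI) (auto simp: polys_on_iff)

lemma mono2_expansion:
  assumes "finite E" "p \<in> polys_on E"
  shows "p = (\<Sum>a\<in>E. smult [:coeff2 p a:] (mono2 a))"
  using assms by (intro coeff2_eqI) (auto simp: coeff2_sum coeff2_mono2 polys_on_iff if_distrib sum.delta cong: if_cong)

lemma
  assumes "finite E"
  shows dim_polys_on: "poly2.dim (polys_on E) = card E"
    and fin_dim_polys_on: "poly2.fin_dim_subspace (polys_on E)"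
proof -
  have inj: "inj_on mono2 E"
    by (rule inj_onI) (metis supp_mono2 singleton_inject)
  have span: "polys_on E \<subseteq> poly2.span (mono2 ` E)"
  proof
    fix p assume "p \<in> polys_on E"
    then show "p \<in> poly2.span (mono2 ` E)"
      by (subst mono2_expansion[OF assms])
        (simp, intro poly2.span_sum poly2.span_scale poly2.span_base imageI)
  qed
  have "poly2.independent (mono2 ` E)"
  proof (rule poly2.independent_if_scalars_zero)
    fix f x assume f: "(\<Sum>x\<in>mono2 ` E. smult [:f x:] x) = 0" and "x \<in> mono2 ` E"
    then obtain a where a: "a \<in> E" "x = mono2 a" by blast
    have "0 = coeff2 (\<Sum>b\<in>E. smult [:f (mono2 b):] (mono2 b)) a"
      using f by (simp add: sum.reindex[OF inj])
    also have "\<dots> = f x"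
      using a assms by (simp add: coeff2_sum coeff2_mono2 if_distrib sum.delta cong: if_cong)
    finally show "f x = 0" by simp
  qed (use assms in simp)
  then have "poly2.dim (polys_on E) = card (mono2 ` E)"
    using span by (intro poly2.basis_card_eq_dim[symmetric]) (auto simp: polys_on_def)
  then show "poly2.dim (polys_on E) = card E"
    using card_image[OF inj] by simp
  show "poly2.fin_dim_subspace (polys_on E)"
    unfolding poly2.fin_dim_subspace_def using subspace_polys_on span assms by blast
qed

definition vanishing_on :: "(nat \<times> nat) set \<Rightarrow> nat \<Rightarrow> real poly poly set" where
  "vanishing_on E k = {p \<in> polys_on E. vanishes_to k p}"

definition vdim :: "(nat \<times> nat) set \<Rightarrow> nat \<Rightarrow> nat" where
  "vdim E k = poly2.dim (vanishing_on E k)"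

lemma subspace_vanishing_on: "poly2.subspace (vanishing_on E k)"
  by (rule poly2.subspaceI)
    (auto simp: vanishing_on_def polys_on_iff vanishes_to_def shift_add shift_scale)

lemma fin_dim_vanishing_on: "finite E \<Longrightarrow> poly2.fin_dim_subspace (vanishing_on E k)"
  using poly2.fin_dim_subspace_subset[OF fin_dim_polys_on subspace_vanishing_on]
  by (auto simp: vanishing_on_def)

lemma vdim_0: "finite E \<Longrightarrow> vdim E 0 = card E"
  using dim_polys_on[of E] by (simp add: vdim_def vanishing_on_def)

lemma vdim_eq_0_iff:
  assumes "finite E"
  shows "vdim E k = 0 \<longleftrightarrow> vanishing_on E k \<subseteq> {0}"
proof -
  obtain B where B: "vanishing_on E k = poly2.span B" "finite B" "card B = poly2.dim (vanishing_on E k)"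
    using poly2.fin_dim_basis[OF fin_dim_vanishing_on[OF assms, of k]] by metis
  show ?thesis
  proof
    assume "vdim E k = 0"
    then show "vanishing_on E k \<subseteq> {0}" using B by (simp add: vdim_def)
  next
    assume "vanishing_on E k \<subseteq> {0}"
    then show "vdim E k = 0"
      using poly2.dim_le_card[of "vanishing_on E k" "{}"] by (simp add: vdim_def)
  qed
qed

section \<open>Counting the conditions imposed by vanishing at (1, 1)\<close>

lemma functional_coeff2_shift: "poly2.functional_on W (\<lambda>p. coeff2 (shift p) a)"
  by (simp add: poly2.functional_on_def shift_add shift_scale)

lemma card_deg_eq: "card {a. deg a = k} = k + 1" and finite_deg_eq: "finite {a. deg a = k}"
proof -
  have eq: "{a. deg a = k} = (\<lambda>i. (i, k - i)) ` {..k}"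
    by (force simp: deg_def image_iff)
  have "inj_on (\<lambda>i. (i, k - i)) {..k}" by (auto simp: inj_on_def)
  from card_image[OF this] show "card {a. deg a = k} = k + 1" by (simp add: eq)
  show "finite {a. deg a = k}" unfolding eq by simp
qed

text \<open>One more order of vanishing costs one linear equation for each of the
  \<open>k + 1\<close> monomials of degree \<open>k\<close>.\<close>

lemma vdim_step:
  assumes "finite E"
  shows "vdim E k \<le> vdim E (k + 1) + (k + 1)"
proof -
  let ?\<Phi> = "(\<lambda>a p. coeff2 (shift p) a) ` {a. deg a = k}"
  have "poly2.dim (vanishing_on E k) \<le>
    poly2.dim {p \<in> vanishing_on E k. \<forall>\<phi>\<in>?\<Phi>. \<phi> p = 0} + card ?\<Phi>"
    using finite_deg_eq functional_coeff2_shift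
    by (intro poly2.dim_le_dim_common_kernel fin_dim_vanishing_on assms) auto
  moreover have "card ?\<Phi> \<le> k + 1"
    using card_image_le[OF finite_deg_eq] card_deg_eq by metis
  moreover have "{p \<in> vanishing_on E k. \<forall>\<phi>\<in>?\<Phi>. \<phi> p = 0} = vanishing_on E (k + 1)"
    by (auto simp: vanishing_on_def vanishes_to_def less_Suc_eq)
  ultimately show ?thesis by (simp add: vdim_def)
qed

definition deg_below :: "nat \<Rightarrow> (nat \<times> nat) set" where
  "deg_below k = {a. deg a < k}"

lemma deg_below_Suc: "deg_below (Suc k) = deg_below k \<union> {a. deg a = k}"
  by (auto simp: deg_below_def)

lemma finite_deg_below [simp]: "finite (deg_below k)"
proof (induction k)
  case 0
  show ?case by (simp add: deg_below_def)
next
  case (Suc k)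
  then show ?case by (simp add: deg_below_Suc finite_deg_eq)
qed

lemma card_deg_below: "2 * card (deg_below k) = k * (k + 1)"
proof (induction k)
  case 0
  then show ?case by (simp add: deg_below_def)
next
  case (Suc k)
  have "card (deg_below (Suc k)) = card (deg_below k) + card {a. deg a = k}"
    unfolding deg_below_Suc
    by (intro card_Un_disjoint finite_deg_below finite_deg_eq) (auto simp: deg_below_def)
  then show ?case using Suc by (simp add: card_deg_eq)
qed

lemma card_deg_below_real: "real (card (deg_below k)) = real k * (real k + 1) / 2"
proof -
  have "real (2 * card (deg_below k)) = real (k * (k + 1))"
    by (simp only: card_deg_below)
  then show ?thesis by (simp add: algebra_simps)
qed

lemma card_le_vdim: "finite E \<Longrightarrow> card E \<le> vdim E k + card (deg_below k)"
proof (induction k)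
  case 0
  then show ?case by (simp add: vdim_0)
next
  case (Suc k)
  have "2 * card (deg_below (Suc k)) = 2 * card (deg_below k) + 2 * (k + 1)"
    by (simp add: card_deg_below)
  then show ?case using Suc vdim_step[of E k] by simp
qed

lemma linear_mult: "Vector_Spaces.linear (\<lambda>c (p::real poly poly). smult [:c:] p) (\<lambda>c p. smult [:c:] p) ((*) f)"
  by (intro Vector_Spaces.linear.intro module_hom.intro module_hom_axioms.intro poly2.vector_space_axioms
      poly2.module_axioms) (simp_all add: algebra_simps)

lemma inj_on_mult: "f \<noteq> 0 \<Longrightarrow> inj_on ((*) f) (A :: real poly poly set)"
  by (simp add: inj_on_def)

lemma shift_polys_on_deg_below:
  assumes "p \<in> polys_on (deg_below k)"
  shows "shift p \<in> polys_on (deg_below k)"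
  unfolding polys_on_iff
proof (intro allI impI)
  fix a assume a: "a \<notin> deg_below k"
  have "real ((fst b choose fst a) * (snd b choose snd a)) = 0" if "b \<in> supp p" for b
  proof -
    have "deg b < deg a"
      using that assms a by (force simp: polys_on_def deg_below_def)
    then have "fst b < fst a \<or> snd b < snd a" by (auto simp: deg_def)
    then show ?thesis by (auto simp: binomial_eq_0)
  qed
  then show "coeff2 (shift p) a = 0"
    unfolding coeff2_shift by (intro sum.neutral) simp
qed

text \<open>A monomial is nonzero at (1, 1) and \<open>shift\<close> does not raise degrees, so a
  nonzero polynomial of degree less than \<open>k\<close>, times a monomial, cannot vanish to order
  \<open>k\<close>. A translate of the simplex \<open>deg_below k\<close> inside \<open>E\<close>
  therefore makes the jet conditions independent.\<close>

lemma vdim_le_if_deg_below: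
  assumes E: "finite E" and sub: "\<And>a. a \<in> deg_below k \<Longrightarrow> c + a \<in> E"
  shows "vdim E k + card (deg_below k) \<le> card E"
proof -
  let ?U = "(*) (mono2 c) ` polys_on (deg_below k)"
  have U: "poly2.dim ?U = card (deg_below k)" "poly2.fin_dim_subspace ?U"
    using poly2.dim_injective_image[OF fin_dim_polys_on linear_mult inj_on_mult] dim_polys_on
      finite_deg_below mono2_nz by simp_all
  have "?U \<subseteq> polys_on E"
    using sub by (fastforce simp: polys_on_def elim!: supp_multE)
  then have "vdim E k + poly2.dim ?U \<le> poly2.dim (polys_on E) + poly2.dim (vanishing_on E k \<inter> ?U)"
    unfolding vdim_def using U(2)
    by (intro poly2.dim_add_le_dim_Int fin_dim_polys_on E subspace_vanishing_on)
      (auto simp: vanishing_on_def poly2.fin_dim_subspace_def)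
  moreover have "vanishing_on E k \<inter> ?U \<subseteq> {0}"
  proof
    fix p assume "p \<in> vanishing_on E k \<inter> ?U"
    then obtain h where h: "p = mono2 c * h" "h \<in> polys_on (deg_below k)" "vanishes_to k p"
      by (auto simp: vanishing_on_def)
    have m1: "mult_at_1 (mono2 c) = 0"
    proof -
      have "coeff2 (shift (mono2 c)) 0 = 1"
        by (simp add: coeff2_shift coeff2_mono2)
      then have "\<not> vanishes_to 1 (mono2 c)"
        unfolding vanishes_to_def by (intro notI) (auto simp: deg_def zero_prod_def)
      then show ?thesis by (simp add: vanishes_to_iff)
    qed
    have "h = 0"
    proof (rule ccontr)
      assume "h \<noteq> 0"
      then have "vanishes_to k h"
        using h m1 by (simp add: vanishes_to_iff mult_at_1_mult)
      then have "shift h = 0"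
        using shift_polys_on_deg_below[OF h(2)]
        by (intro coeff2_eqI) (auto simp: vanishes_to_def polys_on_iff deg_below_def)
      then show False using \<open>h \<noteq> 0\<close> by simp
    qed
    then show "p \<in> {0}" using h by simp
  qed
  then have "poly2.dim (vanishing_on E k \<inter> ?U) = 0"
    using poly2.dim_le_card[of _ "{}"] by simp
  ultimately show ?thesis using U(1) dim_polys_on[OF E] by simp
qed

section \<open>Duality between evaluation and vanishing\<close>

definition eval_at :: "real poly poly \<Rightarrow> real \<times> real \<Rightarrow> real" where
  "eval_at p x = poly (poly p [:snd x:]) (fst x)"

lemma eval_at_superset:
  assumes "finite E" "supp p \<subseteq> E"
  shows "eval_at p x = (\<Sum>b\<in>E. coeff2 p b * (fst x ^ fst b * snd x ^ snd b))"
proof -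
  have pw: "[:y:] ^ n = [:y ^ n:]" for y :: real and n
    by (induction n) (simp_all add: one_pCons)
  have "p \<in> polys_on E" using assms by (simp add: polys_on_def)
  then have "eval_at p x = eval_at (\<Sum>b\<in>E. smult [:coeff2 p b:] (mono2 b)) x"
    using mono2_expansion[OF assms(1)] by metis
  also have "\<dots> = (\<Sum>b\<in>E. coeff2 p b * (fst x ^ fst b * snd x ^ snd b))"
    by (simp add: eval_at_def poly_sum mono2_def poly_monom pw mult_ac)
  finally show ?thesis .
qed

lemma eval_at_add: "eval_at (p + q) x = eval_at p x + eval_at q x"
  and eval_at_scale: "eval_at (smult [:c:] p) x = c * eval_at p x"
  and eval_at_mult: "eval_at (p * q) x = eval_at p x * eval_at q x"
  by (simp_all add: eval_at_def)

text \<open>Lattice points may have negative coordinates, exponents may not: \<open>a\<close> stands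
  for the lattice point obtained by undoing a translation by \<open>z\<close>.\<close>

definition lattice_at :: "real \<times> real \<Rightarrow> nat \<times> nat \<Rightarrow> real \<times> real" where
  "lattice_at z a = (real (fst a) - fst z, real (snd a) - snd z)"

definition pairing :: "real \<times> real \<Rightarrow> (nat \<times> nat) set \<Rightarrow> real poly poly \<Rightarrow> real poly poly \<Rightarrow> real" where
  "pairing z E q g = (\<Sum>a\<in>E. coeff2 g a * eval_at q (lattice_at z a))"

lemma functional_pairing_left: "poly2.functional_on W (\<lambda>q. pairing z E q g)"
  and functional_pairing_right: "poly2.functional_on W (\<lambda>g. pairing z E q g)"
  by (simp_all add: poly2.functional_on_def pairing_def eval_at_add eval_at_scale
      sum.distrib sum_distrib_left algebra_simps)

lemma pairing_mono2: "finite E \<Longrightarrow> a \<in> E \<Longrightarrow> pairing z E q (mono2 a) = eval_at q (lattice_at z a)"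
  by (simp add: pairing_def coeff2_mono2 if_distrib[of "\<lambda>x. x * _"] sum.delta cong: if_cong)

lemma binomial_times_linear:
  "real (n choose l) * (real n - z) = real (l + 1) * real (n choose (l + 1)) + (real l - z) * real (n choose l)"
proof -
  have "real n * real (n choose l) = real (l + 1) * real (n choose (l + 1)) + real l * real (n choose l)"
  proof (cases n)
    case 0
    then show ?thesis by (cases l) auto
  next
    case (Suc m)
    show ?thesis
    proof (cases "l \<le> n")
      case True
      have "(n choose l) * (n - l) = (n choose Suc l) * Suc l"
        by (metis binomial_absorb_comp binomial_absorption mult.commute diff_Suc_1 Suc)
      then have "real (n choose l) * (real n - real l) = real (n choose Suc l) * real (Suc l)"
        using True by (metis of_nat_diff of_nat_mult)
      then show ?thesis by (simp add: algebra_simps)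
    next
      case False
      then show ?thesis by (simp add: binomial_eq_0)
    qed
  qed
  then show ?thesis by (simp add: algebra_simps)
qed

text \<open>Without linear factors this is the vanishing of a Taylor coefficient. By
  \<open>binomial_times_linear\<close> a linear factor with any centre is absorbed into a binomial
  by raising its lower index by at most one, hence the budget
  \<open>l + l' + s + t < k\<close>.\<close>

lemma moments_vanish:
  assumes E: "finite E" and g: "g \<in> vanishing_on E k"
  shows "l + l' + s + t < k \<Longrightarrow>
    (\<Sum>a\<in>E. coeff2 g a * (real (fst a choose l) * real (snd a choose l') *
       ((real (fst a) - x) ^ s * (real (snd a) - y) ^ t))) = 0"
proof (induction "s + t" arbitrary: s t l l')
  case 0
  then have "coeff2 (shift g) (l, l') = 0"
    using g by (auto simp: vanishing_on_def vanishes_to_def deg_def)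
  then show ?case
    using coeff2_shift_superset[OF E, of g "(l, l')"] g 0
    by (simp add: vanishing_on_def polys_on_def)
next
  case (Suc n)
  let ?m = "\<lambda>l l' s t a. coeff2 g a * (real (fst a choose l) * real (snd a choose l') *
       ((real (fst a) - x) ^ s * (real (snd a) - y) ^ t))"
  show ?case
  proof (cases s)
    case (Suc s')
    have "?m l l' s t a = real (l + 1) * ?m (l + 1) l' s' t a + (real l - x) * ?m l l' s' t a" for a
      using arg_cong[OF binomial_times_linear[of "fst a" l x],
        of "\<lambda>r. r * (coeff2 g a * (real (snd a choose l') * ((real (fst a) - x) ^ s' * (real (snd a) - y) ^ t)))"]
      by (simp add: Suc algebra_simps)
    then have "(\<Sum>a\<in>E. ?m l l' s t a) = real (l + 1) * (\<Sum>a\<in>E. ?m (l + 1) l' s' t a) + (real l - x) * (\<Sum>a\<in>E. ?m l l' s' t a)"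
      by (simp only: sum.distrib sum_distrib_left)
    moreover have "(\<Sum>a\<in>E. ?m (l + 1) l' s' t a) = 0" "(\<Sum>a\<in>E. ?m l l' s' t a) = 0"
      using Suc.hyps(1)[of s' t "l + 1" l'] Suc.hyps(1)[of s' t l l'] Suc.hyps(2) Suc.prems Suc by simp_all
    ultimately show ?thesis by simp
  next
    case 0
    then obtain t' where t: "t = Suc t'" using Suc.hyps(2) by (cases t) auto
    have "?m l l' s t a = real (l' + 1) * ?m l (l' + 1) s t' a + (real l' - y) * ?m l l' s t' a" for a
      using arg_cong[OF binomial_times_linear[of "snd a" l' y],
        of "\<lambda>r. r * (coeff2 g a * (real (fst a choose l) * ((real (fst a) - x) ^ s * (real (snd a) - y) ^ t')))"]
      by (simp add: t algebra_simps)
    then have "(\<Sum>a\<in>E. ?m l l' s t a) = real (l' + 1) * (\<Sum>a\<in>E. ?m l (l' + 1) s t' a) + (real l' - y) * (\<Sum>a\<in>E. ?m l l' s t' a)"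
      by (simp only: sum.distrib sum_distrib_left)
    moreover have "(\<Sum>a\<in>E. ?m l (l' + 1) s t' a) = 0" "(\<Sum>a\<in>E. ?m l l' s t' a) = 0"
      using Suc.hyps(1)[of s t' l "l' + 1"] Suc.hyps(1)[of s t' l l'] Suc.hyps(2) Suc.prems t by simp_all
    ultimately show ?thesis by simp
  qed
qed

lemma pairing_vanishing:
  assumes E: "finite E" and g: "g \<in> vanishing_on E k" and q: "q \<in> polys_on (deg_below k)"
  shows "pairing z E q g = 0"
proof -
  have "pairing z E q g = (\<Sum>a\<in>E. \<Sum>b\<in>deg_below k. coeff2 q b * (coeff2 g a *
      ((real (fst a) - fst z) ^ fst b * (real (snd a) - snd z) ^ snd b)))"
    unfolding pairing_def using q
    by (intro sum.cong refl, subst eval_at_superset[OF finite_deg_below])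
      (simp_all add: polys_on_def lattice_at_def sum_distrib_left mult_ac)
  also have "\<dots> = (\<Sum>b\<in>deg_below k. coeff2 q b * (\<Sum>a\<in>E. coeff2 g a *
      ((real (fst a) - fst z) ^ fst b * (real (snd a) - snd z) ^ snd b)))"
    by (subst sum.swap) (simp add: sum_distrib_left)
  also have "\<dots> = 0"
  proof (intro sum.neutral ballI)
    fix b assume "b \<in> deg_below k"
    then have "(\<Sum>a\<in>E. coeff2 g a * ((real (fst a) - fst z) ^ fst b * (real (snd a) - snd z) ^ snd b)) = 0"
      using moments_vanish[OF E g, of 0 0 "fst b" "snd b" "fst z" "snd z"]
      by (simp add: deg_below_def deg_def)
    then show "coeff2 q b * (\<Sum>a\<in>E. coeff2 g a *
      ((real (fst a) - fst z) ^ fst b * (real (snd a) - snd z) ^ snd b)) = 0" by simp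
  qed
  finally show ?thesis .
qed

section \<open>Binomial polynomials and the converse of the duality\<close>

definition binomial_poly :: "real \<Rightarrow> nat \<Rightarrow> real poly" where
  "binomial_poly z l = smult (1 / fact l) (\<Prod>i<l. [:z - of_nat i, 1:])"

lemma poly_binomial_poly: "poly (binomial_poly z l) x = (x + z) gchoose l"
  by (simp add: binomial_poly_def poly_prod gbinomial_prod_rev atLeast0LessThan algebra_simps)

lemma degree_binomial_poly: "degree (binomial_poly z l) \<le> l"
proof -
  have "degree (\<Prod>i<l. [:z - of_nat i, 1:]) \<le> (\<Sum>i<l. degree [:z - of_nat i, 1:])"
    by (rule degree_prod_sum_le[of "{..<l}" "\<lambda>i. [:z - of_nat i, 1:]", unfolded comp_def]) simp
  then show ?thesis by (simp add: binomial_poly_def)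
qed

definition binomial_poly2 :: "real \<times> real \<Rightarrow> nat \<times> nat \<Rightarrow> real poly poly" where
  "binomial_poly2 z b = smult (binomial_poly (fst z) (fst b)) (map_poly (\<lambda>c. [:c:]) (binomial_poly (snd z) (snd b)))"

lemma coeff2_binomial_poly2:
  "coeff2 (binomial_poly2 z b) a = coeff (binomial_poly (fst z) (fst b)) (fst a) * coeff (binomial_poly (snd z) (snd b)) (snd a)"
  by (simp add: coeff2_def binomial_poly2_def coeff_map_poly mult.commute)

lemma binomial_poly2_on:
  assumes "deg b < k"
  shows "binomial_poly2 z b \<in> polys_on (deg_below k)"
  unfolding polys_on_iff
proof (intro allI impI)
  fix a assume "a \<notin> deg_below k"
  then have "fst b < fst a \<or> snd b < snd a" using assms by (auto simp: deg_below_def deg_def)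
  then show "coeff2 (binomial_poly2 z b) a = 0"
    unfolding coeff2_binomial_poly2
    using degree_binomial_poly[of "fst z" "fst b"] degree_binomial_poly[of "snd z" "snd b"]
    by (auto simp: coeff_eq_0)
qed

lemma eval_binomial_poly2:
  "eval_at (binomial_poly2 z b) (lattice_at z a) = real ((fst a choose fst b) * (snd a choose snd b))"
proof -
  have "poly (map_poly (\<lambda>c. [:c:]) r) [:y:] = [:poly r y:]" for r :: "real poly" and y
    by (induction r) (simp_all add: map_poly_pCons)
  then show ?thesis
    by (simp add: eval_at_def binomial_poly2_def lattice_at_def poly_binomial_poly binomial_gbinomial)
qed

text \<open>At the translated lattice points \<open>binomial_poly2 z b\<close> takes exactly the
  weights of \<open>coeff2_shift\<close>, so pairing with it reads off a Taylor coefficient.\<close>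

lemma vanishing_if_pairing:
  assumes E: "finite E" and g: "g \<in> polys_on E"
    and zero: "\<And>q. q \<in> polys_on (deg_below k) \<Longrightarrow> pairing z E q g = 0"
  shows "g \<in> vanishing_on E k"
proof -
  have "coeff2 (shift g) b = 0" if "deg b < k" for b
  proof -
    have "coeff2 (shift g) b = pairing z E (binomial_poly2 z b) g"
      using g coeff2_shift_superset[OF E] by (simp add: pairing_def eval_binomial_poly2 polys_on_def)
    then show ?thesis using zero[OF binomial_poly2_on[OF that]] by simp
  qed
  then show ?thesis using g by (simp add: vanishing_on_def vanishes_to_def)
qed

text \<open>Evaluation on the points is injective in degree less than \<open>k\<close>, and the
  pairing with these polynomials descends to the quotient of \<open>polys_on E\<close> by
  \<open>vanishing_on E k\<close>, whose dimension must therefore be at least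
  \<open>card (deg_below k)\<close>.\<close>

lemma card_add_vdim_le:
  assumes E: "finite E"
    and nz: "\<And>q. q \<in> polys_on (deg_below k) \<Longrightarrow> (\<forall>a\<in>E. eval_at q (lattice_at z a) = 0) \<Longrightarrow> q = 0"
  shows "vdim E k + card (deg_below k) \<le> card E"
proof -
  have "poly2.dim (polys_on (deg_below k)) + poly2.dim (vanishing_on E k) \<le>
    poly2.dim {q \<in> polys_on (deg_below k). \<forall>g\<in>polys_on E. pairing z E q g = 0} + poly2.dim (polys_on E)"
    by (rule poly2.dim_add_le_dim_annihilator[OF fin_dim_polys_on[OF finite_deg_below]
          fin_dim_polys_on[OF E] subspace_vanishing_on _ functional_pairing_left
          functional_pairing_right pairing_vanishing[OF E]])
      (auto simp: vanishing_on_def)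
  moreover have "{q \<in> polys_on (deg_below k). \<forall>g\<in>polys_on E. pairing z E q g = 0} \<subseteq> {0}"
  proof clarify
    fix q assume q: "q \<in> polys_on (deg_below k)" "\<forall>g\<in>polys_on E. pairing z E q g = 0"
    have "eval_at q (lattice_at z a) = 0" if "a \<in> E" for a
      using q(2) pairing_mono2[OF E that, of z q] that by (force simp: polys_on_def)
    then show "q = 0" using nz q by blast
  qed
  then have "poly2.dim {q \<in> polys_on (deg_below k). \<forall>g\<in>polys_on E. pairing z E q g = 0} = 0"
    using poly2.dim_le_card[of _ "{}"] by simp
  ultimately show ?thesis
    by (simp add: dim_polys_on E vdim_def)
qed

text \<open>All multiples of \<open>p\<close> of degree less than \<open>k\<close> pair to zero, so
  at least \<open>card (deg_below (k - r))\<close> of the conditions for order \<open>k\<close> are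
  redundant.\<close>

lemma card_le_vdim_if_vanishing:
  assumes E: "finite E" and p: "p \<noteq> 0" "p \<in> polys_on (deg_below (r + 1))"
    "\<And>a. a \<in> E \<Longrightarrow> eval_at p (lattice_at z a) = 0" and k: "r \<le> k"
  shows "card E + card (deg_below (k - r)) \<le> vdim E k + card (deg_below k)"
proof -
  let ?Q' = "(*) p ` polys_on (deg_below (k - r))"
  have Q': "poly2.dim ?Q' = card (deg_below (k - r))" "poly2.fin_dim_subspace ?Q'"
    using poly2.dim_injective_image[OF fin_dim_polys_on linear_mult inj_on_mult] dim_polys_on
      finite_deg_below p(1) by simp_all
  have "a + b \<in> deg_below k" if "a \<in> deg_below (r + 1)" "b \<in> deg_below (k - r)" for a b
    using that by (simp add: deg_below_def deg_add)
  then have sub: "?Q' \<subseteq> polys_on (deg_below k)"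
    using p(2) by (fastforce simp: polys_on_def elim!: supp_multE)
  have zero: "pairing z E (p * q) g = 0" for q g
    unfolding pairing_def by (intro sum.neutral) (simp add: eval_at_mult p(3))
  have "poly2.dim (polys_on E) + poly2.dim ?Q' \<le>
    poly2.dim {g \<in> polys_on E. \<forall>q\<in>polys_on (deg_below k). pairing z E q g = 0} + poly2.dim (polys_on (deg_below k))"
    using sub Q'(2) zero
    by (intro poly2.dim_add_le_dim_annihilator fin_dim_polys_on E finite_deg_below
        functional_pairing_left functional_pairing_right)
      (auto simp: poly2.fin_dim_subspace_def)
  moreover have "poly2.dim {g \<in> polys_on E. \<forall>q\<in>polys_on (deg_below k). pairing z E q g = 0} \<le> vdim E k"
    unfolding vdim_def using vanishing_if_pairing[OF E]
    by (intro poly2.dim_mono_fin_dim fin_dim_vanishing_on E) blast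
  ultimately show ?thesis
    using Q'(1) by (simp add: dim_polys_on E)
qed

text \<open>Data that cannot be interpolated would yield, by the Fredholm alternative, the
  coefficients of a nonzero polynomial on \<open>E\<close> whose Taylor coefficients of degree at
  most \<open>u\<close> all vanish.\<close>

lemma interpolation_if_vdim_eq_0:
  assumes E: "finite E" and v: "vdim E (u + 1) = 0"
  obtains p where "p \<in> polys_on (deg_below (u + 1))" "\<And>a. a \<in> E \<Longrightarrow> eval_at p (lattice_at z a) = f a"
proof -
  define A where "A = (\<lambda>b a :: nat \<times> nat. real ((fst a choose fst b) * (snd a choose snd b)))"
  from fredholm_alternative[OF E finite_deg_below[of "u + 1"], of f A] show thesis
  proof (elim disjE exE)
    fix c assume c: "\<forall>a\<in>E. f a = (\<Sum>b\<in>deg_below (u + 1). c b * A b a)"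
    let ?p = "\<Sum>b\<in>deg_below (u + 1). smult [:c b:] (binomial_poly2 z b)"
    have eval_sum: "eval_at (sum h B) x = (\<Sum>b\<in>B. eval_at (h b) x)" for h B x
      by (simp add: eval_at_def poly_sum)
    show thesis
    proof
      show "?p \<in> polys_on (deg_below (u + 1))"
        by (intro poly2.subspace_sum poly2.subspace_scale subspace_polys_on binomial_poly2_on)
          (simp add: deg_below_def)
      show "eval_at ?p (lattice_at z a) = f a" if "a \<in> E" for a
        using c that by (simp add: eval_sum eval_at_scale eval_binomial_poly2 A_def)
    qed
  next
    fix x assume x: "(\<forall>b\<in>deg_below (u + 1). (\<Sum>a\<in>E. x a * A b a) = 0) \<and> (\<Sum>a\<in>E. x a * f a) \<noteq> 0"
    let ?g = "\<Sum>a\<in>E. smult [:x a:] (mono2 a)"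
    have co: "coeff2 ?g a = (if a \<in> E then x a else 0)" for a
      using E by (simp add: coeff2_sum coeff2_mono2 if_distrib sum.delta cong: if_cong)
    have on: "?g \<in> polys_on E" by (simp add: polys_on_iff co)
    then have sub: "supp ?g \<subseteq> E" by (simp add: polys_on_def)
    have "coeff2 (shift ?g) b = 0" if "deg b < u + 1" for b
      unfolding coeff2_shift_superset[OF E sub] using x that by (simp add: co A_def deg_below_def)
    then have "?g \<in> vanishing_on E (u + 1)"
      using on by (simp add: vanishing_on_def vanishes_to_def)
    then have "?g = 0" using v vdim_eq_0_iff[OF E] by blast
    then have "x a = 0" if "a \<in> E" for a using co[of a] that by simp
    then have "(\<Sum>a\<in>E. x a * f a) = 0" by (intro sum.neutral) simp
    then show thesis using x by blast
  qed
qed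

text \<open>Interpolating the coefficients of \<open>g\<close> and pairing the result with
  \<open>g\<close> gives a vanishing sum of squares.\<close>

lemma vdim_eq_0_if_interpolation:
  assumes E: "finite E"
    and I: "\<And>f. \<exists>p\<in>polys_on (deg_below k). \<forall>a\<in>E. eval_at p (lattice_at z a) = f a"
  shows "vdim E k = 0"
  unfolding vdim_eq_0_iff[OF E]
proof
  fix g assume g: "g \<in> vanishing_on E k"
  obtain p where p: "p \<in> polys_on (deg_below k)" "\<forall>a\<in>E. eval_at p (lattice_at z a) = coeff2 g a"
    using I[of "coeff2 g"] by blast
  have "(\<Sum>a\<in>E. coeff2 g a * coeff2 g a) = 0"
    using pairing_vanishing[OF E g p(1), of z] p(2) by (simp add: pairing_def)
  then have "\<forall>a\<in>E. coeff2 g a = 0"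
    using sum_nonneg_eq_0_iff[OF E, of "\<lambda>a. coeff2 g a * coeff2 g a"] by simp
  moreover have "\<forall>a. a \<notin> E \<longrightarrow> coeff2 g a = 0"
    using g by (simp add: vanishing_on_def polys_on_iff)
  ultimately have "g = 0" by (metis coeff2_0 coeff2_eqI)
  then show "g \<in> {0}" by simp
qed

section \<open>From exponent sets back to \<open>r_deg\<close> and \<open>s_deg\<close>\<close>

definition pt :: "real \<times> real \<Rightarrow> real ^ 2" where
  "pt x = vector [fst x, snd x]"

lemma pt_nth [simp]: "pt x $ 1 = fst x" "pt x $ 2 = snd x"
  by (simp_all add: pt_def)

lemma eval2_pt: "eval2 p (pt x) = eval_at p x"
  by (simp add: eval2_def eval_at_def)

lemma total_degree_le_iff: "total_degree p \<le> u \<longleftrightarrow> p \<in> polys_on (deg_below (u + 1))"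
proof -
  have "{i + j |i j. coeff (coeff p j) i \<noteq> 0} = deg ` supp p"
    by (force simp: supp_def coeff2_def deg_def image_iff)
  then have "total_degree p = Max (insert 0 (deg ` supp p))"
    by (simp add: total_degree_def)
  also have "\<dots> \<le> u \<longleftrightarrow> (\<forall>a\<in>supp p. deg a \<le> u)"
    by (subst Max_le_iff) auto
  finally show ?thesis
    by (simp add: polys_on_def deg_below_def subset_eq less_Suc_eq_le)
qed

locale lattice_model =
  fixes K :: "(real ^ 2) set" and z :: "real \<times> real" and E :: "(nat \<times> nat) set"
  assumes E: "finite E" and lattice_points_eq: "lattice_points K = (\<lambda>a. pt (lattice_at z a)) ` E"
begin

lemma vdim_add_le_card_if_le_r_deg:
  assumes "k \<le> r_deg K"
  shows "vdim E k + card (deg_below k) \<le> card E"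
proof (rule card_add_vdim_le[OF E])
  fix q assume q: "q \<in> polys_on (deg_below k)" "\<forall>a\<in>E. eval_at q (lattice_at z a) = 0"
  show "q = 0"
  proof (rule ccontr)
    assume nz: "q \<noteq> 0"
    have "\<not> total_degree q < r_deg K"
    proof
      assume "total_degree q < r_deg K"
      from not_less_Least[OF this[unfolded r_deg_def]] show False
        using nz q by (auto simp: lattice_points_eq eval2_pt)
    qed
    moreover have "k \<noteq> 0"
      using q nz by (intro notI) (simp add: polys_on_def deg_below_def)
    ultimately show False
      using total_degree_le_iff[of q "k - 1"] q assms by simp
  qed
qed

lemma r_deg_attained:
  obtains p where "p \<noteq> 0" "p \<in> polys_on (deg_below (r_deg K + 1))"
    "\<And>a. a \<in> E \<Longrightarrow> eval_at p (lattice_at z a) = 0"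
proof -
  have "\<exists>q. q \<noteq> 0 \<and> (\<forall>a\<in>E. eval_at q (lattice_at z a) = 0)"
  proof (rule ccontr)
    assume "\<not> ?thesis"
    \<comment> \<open>Monomials of degree at most \<open>card E\<close> outnumber the points, so
      evaluation on \<open>E\<close> cannot be injective on their span.\<close>
    then have "vdim E (card E + 1) + card (deg_below (card E + 1)) \<le> card E"
      by (intro card_add_vdim_le[OF E, of _ z]) blast
    then show False using card_deg_below[of "card E + 1"] by simp
  qed
  then have "\<exists>r. \<exists>p. p \<noteq> 0 \<and> total_degree p = r \<and> (\<forall>x\<in>lattice_points K. eval2 p x = 0)"
    by (auto simp: lattice_points_eq eval2_pt)
  from LeastI_ex[OF this] obtain p where
    "p \<noteq> 0" "total_degree p = r_deg K" "\<forall>x\<in>lattice_points K. eval2 p x = 0"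
    unfolding r_deg_def by blast
  then show thesis
    using that[of p] total_degree_le_iff[of p "r_deg K"] by (auto simp: lattice_points_eq eval2_pt)
qed

lemma card_le_vdim_if_r_deg_le:
  assumes "r_deg K \<le> k"
  shows "card E + card (deg_below (k - r_deg K)) \<le> vdim E k + card (deg_below k)"
  using r_deg_attained card_le_vdim_if_vanishing[OF E _ _ _ assms] by metis

lemma s_deg_le:
  assumes "vdim E (u + 1) = 0"
  shows "s_deg K \<le> u"
  unfolding s_deg_def
proof (rule Least_le, rule allI)
  fix f :: "real ^ 2 \<Rightarrow> real"
  obtain p where "p \<in> polys_on (deg_below (u + 1))"
    "\<And>a. a \<in> E \<Longrightarrow> eval_at p (lattice_at z a) = f (pt (lattice_at z a))"
    using interpolation_if_vdim_eq_0[OF E assms, of z "\<lambda>a. f (pt (lattice_at z a))"] by metis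
  then show "\<exists>p. total_degree p \<le> u \<and> (\<forall>x\<in>lattice_points K. eval2 p x = f x)"
    by (intro exI[of _ p]) (simp add: total_degree_le_iff lattice_points_eq eval2_pt)
qed

text \<open>The hypothesis makes the set in the definition of \<open>s_deg\<close> nonempty; its
  least element then admits interpolation, which the duality converts back into vanishing of
  \<open>vdim\<close>.\<close>

lemma vdim_s_deg:
  assumes "vdim E (u + 1) = 0"
  shows "vdim E (s_deg K + 1) = 0"
proof -
  have "\<exists>u. \<forall>f :: real ^ 2 \<Rightarrow> real. \<exists>p. total_degree p \<le> u \<and> (\<forall>x\<in>lattice_points K. eval2 p x = f x)"
  proof (intro exI[of _ u] allI)
    fix f :: "real ^ 2 \<Rightarrow> real"
    obtain p where "p \<in> polys_on (deg_below (u + 1))"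
      "\<And>a. a \<in> E \<Longrightarrow> eval_at p (lattice_at z a) = f (pt (lattice_at z a))"
      using interpolation_if_vdim_eq_0[OF E assms, of z "\<lambda>a. f (pt (lattice_at z a))"] by metis
    then show "\<exists>p. total_degree p \<le> u \<and> (\<forall>x\<in>lattice_points K. eval2 p x = f x)"
      by (intro exI[of _ p]) (simp add: total_degree_le_iff lattice_points_eq eval2_pt)
  qed
  from LeastI_ex[OF this] have I: "\<exists>p. total_degree p \<le> s_deg K \<and> (\<forall>x\<in>lattice_points K. eval2 p x = f x)" for f
    unfolding s_deg_def by blast
  have inj: "inj_on (\<lambda>a. pt (lattice_at z a)) E"
  proof (rule inj_onI)
    fix a a' assume "pt (lattice_at z a) = pt (lattice_at z a')"
    then have "lattice_at z a = lattice_at z a'"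
      by (metis pt_nth prod_eq_iff)
    then show "a = a'" by (simp add: lattice_at_def prod_eq_iff)
  qed
  show ?thesis
  proof (rule vdim_eq_0_if_interpolation[OF E])
    fix f :: "nat \<times> nat \<Rightarrow> real"
    obtain p where p: "total_degree p \<le> s_deg K"
      "\<forall>x\<in>lattice_points K. eval2 p x = f (inv_into E (\<lambda>a. pt (lattice_at z a)) x)"
      using I[of "\<lambda>x. f (inv_into E (\<lambda>a. pt (lattice_at z a)) x)"] by blast
    then show "\<exists>p\<in>polys_on (deg_below (s_deg K + 1)). \<forall>a\<in>E. eval_at p (lattice_at z a) = f a"
      using inv_into_f_f[OF inj]
      by (intro bexI[of _ p]) (simp_all add: total_degree_le_iff lattice_points_eq flip: eval2_pt)
  qed
qed

end

section \<open>Lattice points in triangles\<close>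

lemma all_less_3: "(\<forall>i<3::nat. P i) \<longleftrightarrow> P 0 \<and> P 1 \<and> P 2"
  by (auto simp: numeral_3_eq_3 numeral_2_eq_2 less_Suc_eq)

lemma sum_less_3: "(\<Sum>i<3::nat. f i) = (f 0 + f 1 + f 2 :: real)"
  by (simp add: numeral_3_eq_3 numeral_2_eq_2)

lemma all_2: "(\<forall>i::2. P i) \<longleftrightarrow> P 1 \<and> P 2"
  using exhaust_2 by metis

text \<open>The barycentric coordinates of a triangle are \<open>u i * x + v i * y + b i\<close> for \<open>i < 3\<close>.\<close>

locale barycentric =
  fixes u v b :: "nat \<Rightarrow> real"
  assumes sum_u: "(\<Sum>i<3. u i) = 0" and sum_v: "(\<Sum>i<3. v i) = 0" and sum_b: "(\<Sum>i<3. b i) = 1"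
    and det: "u 0 * v 1 - u 1 * v 0 \<noteq> 0"
begin

definition form :: "nat \<Rightarrow> real \<times> real \<Rightarrow> real" where
  "form i x = u i * fst x + v i * snd x"

definition coords :: "real ^ 2 \<Rightarrow> real \<times> real" where
  "coords x = (x $ 1, x $ 2)"

text \<open>A triangle with sides parallel to those of the given one, which is
  \<open>region b\<close>; it degenerates to a point or to the empty set when \<open>e\<close> sums
  to zero or less.\<close>

definition region :: "(nat \<Rightarrow> real) \<Rightarrow> (real ^ 2) set" where
  "region e = {x. \<forall>i<3. - e i \<le> form i (coords x)}"

text \<open>As the three forms sum to zero, this sum is invariant under translation; when positive
  it is the scaling factor of \<open>region e\<close> relative to \<open>region b\<close>.\<close>

definition size3 :: "(nat \<Rightarrow> real) \<Rightarrow> real" where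
  "size3 e = (\<Sum>i<3. e i)"

definition vol :: real where "vol = measure lebesgue (region b)"

definition nat_region :: "(nat \<Rightarrow> real) \<Rightarrow> (nat \<times> nat) set" where
  "nat_region e = {a. \<forall>i<3. - e i \<le> form i (real (fst a), real (snd a))}"

text \<open>Bounds the change of each form when both coordinates move by at most one. Passing from a
  lattice point to its unit square costs \<open>slack\<close> per side, hence
  \<open>3 * slack\<close> in \<open>size3\<close>.\<close>

definition slack :: real where "slack = (\<Sum>i<3. \<bar>u i\<bar> + \<bar>v i\<bar>)"

lemma slack_nonneg: "slack \<ge> 0"
  unfolding slack_def by (intro sum_nonneg) simp

lemma coords_add: "coords (x + y) = coords x + coords y"
  and coords_scaleR: "coords (r *\<^sub>R x) = r *\<^sub>R coords x"
  by (simp_all add: coords_def)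

lemma form_add: "form i (x + y) = form i x + form i y"
  and form_diff: "form i (x - y) = form i x - form i y"
  and form_scaleR: "form i (r *\<^sub>R x) = r * form i x"
  by (simp_all add: form_def algebra_simps)

lemma form_2: "form 2 x = - form 0 x - form 1 x"
proof -
  have u2: "u 2 = - u 0 - u 1" and v2: "v 2 = - v 0 - v 1"
    using sum_u sum_v by (simp_all add: sum_less_3)
  show ?thesis unfolding form_def u2 v2 by (simp add: algebra_simps)
qed

lemma abs_form_le:
  assumes "i < 3" "\<bar>fst x\<bar> \<le> r" "\<bar>snd x\<bar> \<le> r"
  shows "\<bar>form i x\<bar> \<le> slack * r"
proof -
  have "\<bar>form i x\<bar> \<le> \<bar>u i\<bar> * \<bar>fst x\<bar> + \<bar>v i\<bar> * \<bar>snd x\<bar>"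
    unfolding form_def by (metis abs_mult abs_triangle_ineq)
  also have "\<dots> \<le> \<bar>u i\<bar> * r + \<bar>v i\<bar> * r"
    using assms by (intro add_mono mult_left_mono) auto
  also have "\<dots> = (\<bar>u i\<bar> + \<bar>v i\<bar>) * r" by (simp add: algebra_simps)
  also have "\<dots> \<le> slack * r"
    unfolding slack_def using assms by (intro mult_right_mono member_le_sum) auto
  finally show ?thesis .
qed

lemma solve_form:
  assumes "(\<Sum>i<3. w i) = 0"
  obtains z where "\<forall>i<3. form i (coords z) = w i"
proof -
  let ?D = "u 0 * v 1 - u 1 * v 0"
  let ?z = "vector [(w 0 * v 1 - w 1 * v 0) / ?D, (u 0 * w 1 - u 1 * w 0) / ?D] :: real ^ 2"
  have z01: "form 0 (coords ?z) = w 0" "form 1 (coords ?z) = w 1"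
    using det by (simp_all add: form_def coords_def divide_simps) (simp_all add: algebra_simps)
  moreover have "form 2 (coords ?z) = w 2"
    using assms z01 by (simp add: form_2 sum_less_3)
  ultimately have "\<forall>i<3. form i (coords ?z) = w i" by (simp add: all_less_3)
  then show thesis using that by blast
qed

lemma form_bound:
  assumes "\<And>i. i < 3 \<Longrightarrow> - e i \<le> form i x" and "i < 3"
  shows "\<bar>form i x\<bar> \<le> (\<Sum>i<3. \<bar>e i\<bar>)"
proof -
  have "- e 0 \<le> form 0 x" "- e 1 \<le> form 1 x" "- e 2 \<le> - form 0 x - form 1 x"
    using assms(1)[of 0] assms(1)[of 1] assms(1)[of 2] by (simp_all add: form_2)
  then have "\<forall>i<3. \<bar>form i x\<bar> \<le> (\<Sum>i<3. \<bar>e i\<bar>)"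
    unfolding all_less_3 sum_less_3 form_2 by linarith
  then show ?thesis using assms(2) by blast
qed

lemma coordinate_bound:
  assumes "\<And>i. i < 3 \<Longrightarrow> - e i \<le> form i x"
  shows "\<bar>fst x\<bar> \<le> slack * (\<Sum>i<3. \<bar>e i\<bar>) / \<bar>u 0 * v 1 - u 1 * v 0\<bar>"
    and "\<bar>snd x\<bar> \<le> slack * (\<Sum>i<3. \<bar>e i\<bar>) / \<bar>u 0 * v 1 - u 1 * v 0\<bar>"
proof -
  let ?D = "u 0 * v 1 - u 1 * v 0" and ?M = "\<Sum>i<3. \<bar>e i\<bar>"
  have f: "\<bar>form 0 x\<bar> \<le> ?M" "\<bar>form 1 x\<bar> \<le> ?M"
    using form_bound[of e x 0] form_bound[of e x 1] assms by simp_all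
  have M: "?M \<ge> 0" by (intro sum_nonneg) simp
  have sl: "\<bar>v 0\<bar> + \<bar>v 1\<bar> \<le> slack" "\<bar>u 0\<bar> + \<bar>u 1\<bar> \<le> slack"
    by (simp_all add: slack_def sum_less_3)
  have "\<bar>fst x\<bar> * \<bar>?D\<bar> = \<bar>form 0 x * v 1 - form 1 x * v 0\<bar>"
    by (simp add: form_def flip: abs_mult) (simp add: algebra_simps)
  also have "\<dots> \<le> \<bar>form 0 x\<bar> * \<bar>v 1\<bar> + \<bar>form 1 x\<bar> * \<bar>v 0\<bar>"
    by (metis abs_mult abs_triangle_ineq4)
  also have "\<dots> \<le> ?M * \<bar>v 1\<bar> + ?M * \<bar>v 0\<bar>"
    using f by (intro add_mono mult_right_mono) auto
  also have "\<dots> = (\<bar>v 0\<bar> + \<bar>v 1\<bar>) * ?M" by (simp add: algebra_simps)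
  also have "\<dots> \<le> slack * ?M" using sl M by (intro mult_right_mono) auto
  finally show "\<bar>fst x\<bar> \<le> slack * ?M / \<bar>?D\<bar>"
    using det by (simp add: pos_le_divide_eq)
  have "\<bar>snd x\<bar> * \<bar>?D\<bar> = \<bar>form 1 x * u 0 - form 0 x * u 1\<bar>"
    by (simp add: form_def flip: abs_mult) (simp add: algebra_simps)
  also have "\<dots> \<le> \<bar>form 1 x\<bar> * \<bar>u 0\<bar> + \<bar>form 0 x\<bar> * \<bar>u 1\<bar>"
    by (metis abs_mult abs_triangle_ineq4)
  also have "\<dots> \<le> ?M * \<bar>u 0\<bar> + ?M * \<bar>u 1\<bar>"
    using f by (intro add_mono mult_right_mono) auto
  also have "\<dots> = (\<bar>u 0\<bar> + \<bar>u 1\<bar>) * ?M" by (simp add: algebra_simps)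
  also have "\<dots> \<le> slack * ?M" using sl M by (intro mult_right_mono) auto
  finally show "\<bar>snd x\<bar> \<le> slack * ?M / \<bar>?D\<bar>"
    using det by (simp add: pos_le_divide_eq)
qed

lemma finite_nat_region [simp]: "finite (nat_region e)"
proof -
  define R where "R = slack * (\<Sum>i<3. \<bar>e i\<bar>) / \<bar>u 0 * v 1 - u 1 * v 0\<bar>"
  have "nat_region e \<subseteq> {..nat \<lfloor>R\<rfloor>} \<times> {..nat \<lfloor>R\<rfloor>}"
  proof
    fix a assume "a \<in> nat_region e"
    then have "real (fst a) \<le> R" "real (snd a) \<le> R"
      using coordinate_bound[of e "(real (fst a), real (snd a))"] unfolding R_def
      by (simp_all add: nat_region_def)
    then have "fst a \<le> nat \<lfloor>R\<rfloor>" "snd a \<le> nat \<lfloor>R\<rfloor>"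
      by (simp_all add: le_nat_floor)
    then show "a \<in> {..nat \<lfloor>R\<rfloor>} \<times> {..nat \<lfloor>R\<rfloor>}" by (simp add: mem_Times_iff)
  qed
  then show ?thesis by (rule finite_subset) simp
qed

lemma compact_region: "compact (region e)"
proof -
  define R where "R = slack * (\<Sum>i<3. \<bar>e i\<bar>) / \<bar>u 0 * v 1 - u 1 * v 0\<bar>"
  have "region e \<subseteq> cbox (\<chi> i. - R) (\<chi> i. R)"
  proof
    fix x assume "x \<in> region e"
    then have "\<bar>x $ 1\<bar> \<le> R" "\<bar>x $ 2\<bar> \<le> R"
      using coordinate_bound[of e "coords x"] unfolding R_def
      by (simp_all add: region_def coords_def)
    then show "x \<in> cbox (\<chi> i. - R) (\<chi> i. R)"
      by (simp add: mem_box_cart all_2 abs_le_iff)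
  qed
  then have "bounded (region e)" by (rule bounded_subset[OF bounded_cbox])
  moreover have "closed (region e)"
    unfolding region_def form_def coords_def
    by (simp add: all_less_3) (intro closed_Collect_conj closed_Collect_le continuous_intros)
  ultimately show ?thesis by (simp add: compact_eq_bounded_closed)
qed

lemma region_lmeasurable: "region e \<in> lmeasurable"
  by (rule lmeasurable_compact[OF compact_region])

lemma size3_diff: "size3 (\<lambda>i. e i - f i) = size3 e - size3 f"
  and size3_const: "size3 (\<lambda>i. e i + c) = size3 e + 3 * c"
  and size3_scale: "size3 (\<lambda>i. c * e i) = c * size3 e"
  by (simp_all add: size3_def sum.distrib sum_subtractf sum_distrib_left)

text \<open>The translation vector \<open>z\<close> exists because the changes required of the three
  forms sum to zero.\<close>

lemma region_eq_affine_image: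
  assumes "size3 e > 0"
  obtains z where "region e = (\<lambda>x. z + size3 e *\<^sub>R x) ` region b"
proof -
  have "(\<Sum>i<3. size3 e * b i - e i) = 0"
    using sum_b by (simp add: sum_subtractf size3_def flip: sum_distrib_left)
  from solve_form[OF this] obtain z where z: "\<forall>i<3. form i (coords z) = size3 e * b i - e i"
    by blast
  have "z + size3 e *\<^sub>R x \<in> region e \<longleftrightarrow> x \<in> region b" for x
  proof -
    have "- e i \<le> form i (coords (z + size3 e *\<^sub>R x)) \<longleftrightarrow> - b i \<le> form i (coords x)" if "i < 3" for i
    proof -
      have "- e i \<le> form i (coords (z + size3 e *\<^sub>R x)) \<longleftrightarrow> size3 e * (- b i) \<le> size3 e * form i (coords x)"
        using z that by (auto simp: coords_add coords_scaleR form_add form_scaleR)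
      then show ?thesis using assms by (simp only: mult_le_cancel_left_pos)
    qed
    then show ?thesis by (simp add: region_def)
  qed
  moreover have "y = z + size3 e *\<^sub>R ((1 / size3 e) *\<^sub>R (y - z))" for y
    using assms by simp
  ultimately have "region e = (\<lambda>x. z + size3 e *\<^sub>R x) ` region b"
    by (metis (no_types, lifting) image_iff subsetI subset_antisym)
  then show thesis by (rule that)
qed

lemma measure_region:
  assumes "size3 e \<ge> 0"
  shows "measure lebesgue (region e) = vol * (size3 e)\<^sup>2"
proof (cases "size3 e = 0")
  case False
  then obtain z where "region e = (\<lambda>x. z + size3 e *\<^sub>R x) ` region b"
    using region_eq_affine_image[of e] assms by (metis order_le_imp_less_or_eq)
  also have "(\<lambda>x. z + size3 e *\<^sub>R x) = (\<lambda>x. size3 e *\<^sub>R x + z)"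
    by (intro ext) (rule add.commute)
  finally show ?thesis
    using measure_lebesgue_affine[of "size3 e" z "region b"] by (simp add: vol_def mult.commute)
next
  case True
  \<comment> \<open>With total size zero all three inequalities are equalities, so at most one point
    is left.\<close>
  have "x = y" if "x \<in> region e" "y \<in> region e" for x y
  proof -
    have "form i (coords x) = - e i" if x: "x \<in> region e" and i: "i < 3" for x i
    proof -
      have "\<forall>i<3. - e i \<le> form i (coords x)" using x by (simp add: region_def)
      then have "- e 0 \<le> form 0 (coords x)" "- e 1 \<le> form 1 (coords x)"
        "- e 2 \<le> - form 0 (coords x) - form 1 (coords x)"
        unfolding all_less_3 form_2 by auto
      then have "\<forall>i<3. form i (coords x) = - e i"
        using True unfolding size3_def sum_less_3 all_less_3 form_2 by linarith
      then show ?thesis using i by blast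
    qed
    then have "form i (coords x - coords y) = 0" if "i < 3" for i
      using that \<open>x \<in> region e\<close> \<open>y \<in> region e\<close> by (simp add: form_diff)
    then have "\<bar>fst (coords x - coords y)\<bar> \<le> 0" "\<bar>snd (coords x - coords y)\<bar> \<le> 0"
      using coordinate_bound[of "\<lambda>_. 0" "coords x - coords y"] by simp_all
    then show ?thesis by (simp add: coords_def vec_eq_iff all_2)
  qed
  then have "region e = {} \<or> (\<exists>x. region e = {x})" by blast
  then have "measure lebesgue (region e) = 0" by auto
  then show ?thesis using True by simp
qed

lemma vol_pos: "vol > 0"
proof -
  let ?U = "{x::real^2. \<forall>i<3. - b i < form i (coords x)}"
  have "open ?U"
    unfolding form_def coords_def
    by (simp add: all_less_3) (intro open_Collect_conj open_Collect_less continuous_intros)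
  moreover have "?U \<noteq> {}"
  proof -
    have "(\<Sum>i<3. 1 / 3 - b i) = 0" using sum_b by (simp add: sum_less_3)
    from solve_form[OF this] obtain z where "\<forall>i<3. form i (coords z) = 1 / 3 - b i"
      by blast
    then have "z \<in> ?U" by simp
    then show ?thesis by blast
  qed
  moreover have "?U \<subseteq> region b" by (auto simp: region_def less_imp_le)
  ultimately have "\<not> negligible (region b)"
    using open_not_negligible negligible_subset by blast
  then show ?thesis
    using negligible_iff_measure0[OF region_lmeasurable, of b] measure_nonneg[of lebesgue "region b"]
    unfolding vol_def by linarith
qed

section \<open>Counting lattice points by unit squares\<close>

lemma measure_unit_cube:
  fixes x :: "real ^ 2"
  shows "measure lebesgue (cbox x (x + 1)) = 1" "measure lebesgue (box x (x + 1)) = 1"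
proof -
  have "measure lborel (cbox x (x + 1)) = 1"
    by (subst content_cbox_if_cart) (simp add: interval_eq_empty_cart)
  then have "(\<Prod>i\<in>Basis. (x + 1 - x) \<bullet> i) = 1"
    by (subst (asm) measure_lborel_cbox_eq) (auto split: if_splits)
  moreover have "\<forall>i\<in>Basis. x \<bullet> i \<le> (x + 1) \<bullet> i"
    by (auto simp: Basis_vec_def inner_axis)
  ultimately have "measure lborel (box x (x + 1)) = 1"
    by (simp add: measure_lborel_box_eq)
  then show "measure lebesgue (box x (x + 1)) = 1" by simp
  show "measure lebesgue (cbox x (x + 1)) = 1"
    using \<open>measure lborel (cbox x (x + 1)) = 1\<close> by simp
qed

definition corner :: "nat \<times> nat \<Rightarrow> real ^ 2" where
  "corner a = vector [real (fst a), real (snd a)]"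

lemma corner_nth [simp]: "corner a $ 1 = real (fst a)" "corner a $ 2 = real (snd a)"
  by (simp_all add: corner_def)

text \<open>The open unit squares at the points are disjoint and lie in the triangle whose sides are
  all relaxed by \<open>slack\<close>.\<close>

lemma card_nat_region_le:
  assumes "size3 e + 3 * slack \<ge> 0"
  shows "real (card (nat_region e)) \<le> vol * (size3 e + 3 * slack)\<^sup>2"
proof -
  let ?B = "\<lambda>a. box (corner a) (corner a + 1)"
  have disj: "pairwise (\<lambda>a a'. disjnt (?B a) (?B a')) (nat_region e)"
  proof (rule pairwiseI)
    fix a a' :: "nat \<times> nat" assume "a \<noteq> a'"
    have "False" if "x \<in> ?B a" "x \<in> ?B a'" for x
    proof -
      have "real (fst a) < real (fst a') + 1" "real (fst a') < real (fst a) + 1"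
        "real (snd a) < real (snd a') + 1" "real (snd a') < real (snd a) + 1"
        using that by (simp_all add: mem_box_cart all_2)
      then have "a = a'" by (auto simp: prod_eq_iff)
      then show False using \<open>a \<noteq> a'\<close> by blast
    qed
    then show "disjnt (?B a) (?B a')" by (auto simp: disjnt_def)
  qed
  have "real (card (nat_region e)) = (\<Sum>a\<in>nat_region e. measure lebesgue (?B a))"
    by (simp add: measure_unit_cube del: measure_completion)
  also have "\<dots> = measure lebesgue (\<Union>a\<in>nat_region e. ?B a)"
    by (rule measure_UNION'[symmetric]) (use disj in simp_all)
  also have "\<dots> \<le> measure lebesgue (region (\<lambda>i. e i + slack))"
  proof (rule measure_mono_fmeasurable)
    show "(\<Union>a\<in>nat_region e. ?B a) \<subseteq> region (\<lambda>i. e i + slack)"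
    proof
      fix x assume "x \<in> (\<Union>a\<in>nat_region e. ?B a)"
      then obtain a where a: "a \<in> nat_region e" "x \<in> ?B a" by blast
      have "- (e i + slack) \<le> form i (coords x)" if i: "i < 3" for i
      proof -
        have "\<bar>form i (coords x - coords (corner a))\<bar> \<le> slack * 1"
          using a(2) by (intro abs_form_le[OF i]) (auto simp: coords_def mem_box_cart all_2)
        moreover have "- e i \<le> form i (coords (corner a))"
          using a(1) i by (simp add: nat_region_def coords_def)
        ultimately show ?thesis by (simp add: form_diff)
      qed
      then show "x \<in> region (\<lambda>i. e i + slack)" by (simp add: region_def)
    qed
  qed (auto simp: region_lmeasurable intro!: fmeasurable.finite_UN)
  also have "\<dots> = vol * (size3 e + 3 * slack)\<^sup>2"
    using assms measure_region[of "\<lambda>i. e i + slack"] by (simp add: size3_const)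
  finally show ?thesis .
qed

text \<open>Rounding down sends a point of the triangle tightened by \<open>slack\<close> to a
  lattice point of \<open>region e\<close>; by \<open>pos\<close> its coordinates are natural
  numbers.\<close>

lemma card_nat_region_ge:
  assumes size: "size3 e \<ge> 3 * slack"
    and pos: "\<And>x. x \<in> region e \<Longrightarrow> x $ 1 \<ge> 0 \<and> x $ 2 \<ge> 0"
  shows "vol * (size3 e - 3 * slack)\<^sup>2 \<le> real (card (nat_region e))"
proof -
  let ?B = "\<lambda>a. cbox (corner a) (corner a + 1)"
  have sub: "region (\<lambda>i. e i + - slack) \<subseteq> (\<Union>a\<in>nat_region e. ?B a)"
  proof
    fix x assume x: "x \<in> region (\<lambda>i. e i + - slack)"
    have xe: "- e i + slack \<le> form i (coords x)" if "i < 3" for i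
      using x that by (force simp: region_def)
    then have "x \<in> region e"
      using slack_nonneg by (force simp: region_def)
    then have p: "x $ 1 \<ge> 0" "x $ 2 \<ge> 0" using pos by blast+
    define a where "a = (nat \<lfloor>x $ 1\<rfloor>, nat \<lfloor>x $ 2\<rfloor>)"
    have fl: "real (fst a) \<le> x $ 1" "x $ 1 \<le> real (fst a) + 1"
      "real (snd a) \<le> x $ 2" "x $ 2 \<le> real (snd a) + 1"
      unfolding a_def using p by (simp_all; linarith)+
    then have "x \<in> ?B a" by (simp add: mem_box_cart all_2)
    moreover have "a \<in> nat_region e"
    proof -
      have "- e i \<le> form i (real (fst a), real (snd a))" if i: "i < 3" for i
      proof -
        have "\<bar>form i (coords x - (real (fst a), real (snd a)))\<bar> \<le> slack * 1"
          using fl by (intro abs_form_le[OF i]) (auto simp: coords_def)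
        then show ?thesis using xe[OF i] by (simp add: form_diff)
      qed
      then show ?thesis by (simp add: nat_region_def)
    qed
    ultimately show "x \<in> (\<Union>a\<in>nat_region e. ?B a)" by blast
  qed
  have "vol * (size3 e - 3 * slack)\<^sup>2 = measure lebesgue (region (\<lambda>i. e i + - slack))"
    using size measure_region[of "\<lambda>i. e i + - slack"] by (simp only: size3_const) simp
  also have "\<dots> \<le> measure lebesgue (\<Union>a\<in>nat_region e. ?B a)"
    using sub by (intro measure_mono_fmeasurable fmeasurable.finite_UN)
      (auto intro: fmeasurableD[OF region_lmeasurable])
  also have "\<dots> \<le> (\<Sum>a\<in>nat_region e. measure lebesgue (?B a))"
    by (intro measure_UNION_le) auto
  also have "\<dots> = real (card (nat_region e))"
    by (simp add: measure_unit_cube del: measure_completion)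
  finally show ?thesis .
qed

lemma nat_region_empty: "size3 e < 0 \<Longrightarrow> nat_region e = {}"
proof (rule ccontr)
  assume "size3 e < 0" "nat_region e \<noteq> {}"
  then obtain a where "\<forall>i<3. - e i \<le> form i (real (fst a), real (snd a))"
    by (auto simp: nat_region_def)
  then show False
    using \<open>size3 e < 0\<close> unfolding all_less_3 size3_def sum_less_3 form_2 by linarith
qed

end

text \<open>Cramer's rule, with \<open>D\<close> twice the signed area: coordinate 0 belongs to the
  vertex \<open>b\<close>, 1 to \<open>c\<close> and 2 to \<open>a\<close>.\<close>

lemma triangle_barycentric:
  fixes a b c :: "real ^ 2"
  assumes "\<not> collinear {a, b, c}"
  obtains u v w where "barycentric u v w" "convex hull {a, b, c} = barycentric.region u v w"
proof -
  define D where "D = (b$1 - a$1) * (c$2 - a$2) - (b$2 - a$2) * (c$1 - a$1)"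
  have D: "D \<noteq> 0"
  proof
    assume D0: "D = 0"
    then have e: "(b$1 - a$1) * (c$2 - a$2) = (b$2 - a$2) * (c$1 - a$1)"
      by (simp add: D_def)
    have "a \<noteq> b" using assms by (auto simp: insert_absorb)
    then consider "b$1 \<noteq> a$1" | "b$2 \<noteq> a$2" by (auto simp: vec_eq_iff all_2)
    then have "\<exists>t. c - a = t *\<^sub>R (b - a)"
    proof cases
      case 1
      then have "c$2 - a$2 = (c$1 - a$1) / (b$1 - a$1) * (b$2 - a$2)"
        using e by (simp add: nonzero_eq_divide_eq mult.commute)
      with 1 show ?thesis
        by (intro exI[of _ "(c$1 - a$1) / (b$1 - a$1)"]) (simp add: vec_eq_iff all_2)
    next
      case 2
      then have "c$1 - a$1 = (c$2 - a$2) / (b$2 - a$2) * (b$1 - a$1)"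
        using e by (simp add: nonzero_eq_divide_eq mult.commute)
      with 2 show ?thesis
        by (intro exI[of _ "(c$2 - a$2) / (b$2 - a$2)"]) (simp add: vec_eq_iff all_2)
    qed
    then have "collinear {0, b - a, c - a}" by (simp add: collinear_lemma)
    then have "collinear {b, a, c}" by (simp add: collinear_3)
    then show False using assms by (simp add: insert_commute)
  qed
  define p0 where "p0 = (c$2 - a$2) / D"
  define p1 where "p1 = - (b$2 - a$2) / D"
  define q0 where "q0 = - (c$1 - a$1) / D"
  define q1 where "q1 = (b$1 - a$1) / D"
  define u where "u = (\<lambda>i::nat. if i = 0 then p0 else if i = 1 then p1 else - p0 - p1)"
  define v where "v = (\<lambda>i::nat. if i = 0 then q0 else if i = 1 then q1 else - q0 - q1)"
  define w where "w = (\<lambda>i::nat. if i = 0 then - (p0 * a$1 + q0 * a$2)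
    else if i = 1 then - (p1 * a$1 + q1 * a$2)
    else 1 + (p0 * a$1 + q0 * a$2) + (p1 * a$1 + q1 * a$2))"
  note defs = u_def v_def w_def p0_def p1_def q0_def q1_def
  have "u 0 * v 1 - u 1 * v 0 = ((b$1 - a$1) * (c$2 - a$2) - (b$2 - a$2) * (c$1 - a$1)) / (D * D)"
    by (simp add: defs algebra_simps diff_divide_distrib add_divide_distrib)
  also have "\<dots> = D / (D * D)" by (simp add: D_def)
  finally have "u 0 * v 1 - u 1 * v 0 = D / (D * D)" .
  then interpret barycentric u v w
    using D by unfold_locales (simp_all add: sum_less_3 u_def v_def w_def)
  define B where "B = (\<lambda>i x. form i (coords x) + w i)"
  have B_affine: "B i (r *\<^sub>R a + s *\<^sub>R b + t *\<^sub>R c) = r * B i a + s * B i b + t * B i c"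
    if "r + s + t = 1" for i r s t
  proof -
    have "w i = r * w i + s * w i + t * w i" using that by (metis distrib_right mult_1)
    then show ?thesis
      by (simp add: B_def coords_add coords_scaleR form_add form_scaleR algebra_simps)
  qed
  have at: "u 0 = p0" "u 1 = p1" "v 0 = q0" "v 1 = q1" "w 0 = - (p0 * a$1 + q0 * a$2)"
    "w 1 = - (p1 * a$1 + q1 * a$2)"
    by (simp_all add: u_def v_def w_def)
  have B0: "B 0 x = ((x$1 - a$1) * (c$2 - a$2) - (x$2 - a$2) * (c$1 - a$1)) / D"
    and B1: "B 1 x = ((x$2 - a$2) * (b$1 - a$1) - (x$1 - a$1) * (b$2 - a$2)) / D" for x
    by (simp_all only: B_def form_def coords_def at p0_def p1_def q0_def q1_def fst_conv snd_conv)
      (simp_all add: algebra_simps diff_divide_distrib add_divide_distrib)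
  have vertex0: "B 0 a = 0" "B 0 b = 1" "B 0 c = 0"
    unfolding B0 using D by (simp_all add: D_def mult.commute)
  have vertex1: "B 1 a = 0" "B 1 b = 0" "B 1 c = 1"
    unfolding B1 using D by (simp_all add: D_def mult.commute)
  have sumB: "B 2 x = 1 - B 0 x - B 1 x" for x
    by (simp add: B_def form_2 at) (simp add: w_def)
  have reg: "x \<in> region w \<longleftrightarrow> 0 \<le> B 0 x \<and> 0 \<le> B 1 x \<and> 0 \<le> B 2 x" for x
    unfolding region_def all_less_3 B_def by auto
  have "convex hull {a, b, c} = region w"
  proof (intro equalityI subsetI)
    fix x assume "x \<in> convex hull {a, b, c}"
    then obtain r s t where rst: "x = r *\<^sub>R a + s *\<^sub>R b + t *\<^sub>R c" "0 \<le> r" "0 \<le> s" "0 \<le> t" "r + s + t = 1"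
      by (auto simp: convex_hull_3)
    then have "B 0 x = s" "B 1 x = t" "B 2 x = r"
      using B_affine[OF rst(5)] vertex0 vertex1 by (simp_all add: sumB)
    then show "x \<in> region w" using rst by (simp add: reg)
  next
    fix x assume x: "x \<in> region w"
    have "x = B 2 x *\<^sub>R a + B 0 x *\<^sub>R b + B 1 x *\<^sub>R c"
    proof -
      have "(x$1 - a$1) * D = (B 0 x * D) * (b$1 - a$1) + (B 1 x * D) * (c$1 - a$1)"
        "(x$2 - a$2) * D = (B 0 x * D) * (b$2 - a$2) + (B 1 x * D) * (c$2 - a$2)"
        unfolding B0 B1 using D by simp_all (simp_all add: D_def algebra_simps)
      then have "(x$1 - a$1) * D = (B 0 x * (b$1 - a$1) + B 1 x * (c$1 - a$1)) * D"
        "(x$2 - a$2) * D = (B 0 x * (b$2 - a$2) + B 1 x * (c$2 - a$2)) * D"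
        by (simp_all add: algebra_simps)
      then have "x$1 - a$1 = B 0 x * (b$1 - a$1) + B 1 x * (c$1 - a$1)"
        "x$2 - a$2 = B 0 x * (b$2 - a$2) + B 1 x * (c$2 - a$2)"
        using D by simp_all
      then show ?thesis
        unfolding vec_eq_iff all_2 sumB by (simp add: algebra_simps)
    qed
    then show "x \<in> convex hull {a, b, c}"
      using x unfolding convex_hull_3 reg by (intro CollectI exI[of _ "B 2 x"] exI[of _ "B 0 x"] exI[of _ "B 1 x"])
        (simp add: sumB)
  qed
  then show thesis using that barycentric_axioms by blast
qed

section \<open>An intersection inequality\<close>

context barycentric
begin

definition nform :: "nat \<Rightarrow> nat \<times> nat \<Rightarrow> real" where
  "nform i a = form i (real (fst a), real (snd a))"

lemma nform_add: "nform i (a + c) = nform i a + nform i c"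
  by (simp add: nform_def form_def algebra_simps)

lemma nform_0 [simp]: "nform i 0 = 0"
  by (simp add: nform_def form_def)

lemma form_corner: "form i (coords (corner a)) = nform i a"
  by (simp add: nform_def coords_def)

lemma nat_region_iff: "a \<in> nat_region e \<longleftrightarrow> (\<forall>i<3. - e i \<le> nform i a)"
  by (simp add: nat_region_def nform_def)

text \<open>\<open>nat_region (tight f)\<close> is the smallest homothetic copy of the triangle that contains the
  exponents of \<open>f\<close>, and \<open>tau f\<close> is its scaling factor.\<close>

definition tight :: "real poly poly \<Rightarrow> nat \<Rightarrow> real" where
  "tight f i = - weight (nform i) f"

definition tau :: "real poly poly \<Rightarrow> real" where
  "tau f = size3 (tight f)"

lemma polys_on_nat_region_iff:
  "f \<noteq> 0 \<Longrightarrow> f \<in> polys_on (nat_region e) \<longleftrightarrow> (\<forall>i<3. tight f i \<le> e i)"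
proof -
  assume "f \<noteq> 0"
  then have "tight f i \<le> e i \<longleftrightarrow> (\<forall>a\<in>supp f. - e i \<le> nform i a)" for i
    using weight_ge_iff[of f "- e i" "nform i"] by (simp add: tight_def minus_le_iff)
  then show ?thesis
    unfolding polys_on_def mem_Collect_eq subset_eq nat_region_iff by metis
qed

lemma tight_mult: "f \<noteq> 0 \<Longrightarrow> g \<noteq> 0 \<Longrightarrow> tight (f * g) i = tight f i + tight g i"
  by (simp add: tight_def weight_mult nform_add)

lemma tight_power: "f \<noteq> 0 \<Longrightarrow> tight (f ^ n) i = real n * tight f i"
  by (induction n) (simp_all add: tight_mult algebra_simps, simp add: tight_def weight_1)

lemma tau_mult: "f \<noteq> 0 \<Longrightarrow> g \<noteq> 0 \<Longrightarrow> tau (f * g) = tau f + tau g"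
  by (simp add: tau_def size3_def tight_mult sum.distrib)

lemma tau_1 [simp]: "tau 1 = 0"
  by (simp add: tau_def size3_def tight_def weight_1)

lemma size3_mono: "(\<And>i. i < 3 \<Longrightarrow> e i \<le> e' i) \<Longrightarrow> size3 e \<le> size3 e'"
  unfolding size3_def by (intro sum_mono) simp

lemma tau_le_size3: "f \<noteq> 0 \<Longrightarrow> f \<in> polys_on (nat_region e) \<Longrightarrow> tau f \<le> size3 e"
  unfolding tau_def by (intro size3_mono) (simp add: polys_on_nat_region_iff)

lemma tau_nonneg:
  assumes "f \<noteq> 0"
  shows "tau f \<ge> 0"
proof (rule ccontr)
  assume "\<not> tau f \<ge> 0"
  then have "nat_region (tight f) = {}"
    by (intro nat_region_empty) (simp add: tau_def)
  moreover have "f \<in> polys_on (nat_region (tight f))"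
    using assms by (simp add: polys_on_nat_region_iff)
  ultimately show False using assms by (simp add: polys_on_def)
qed

definition shifted :: "real \<Rightarrow> nat \<Rightarrow> nat \<Rightarrow> real" where
  "shifted N z i = N * b i - nform i (z, z)"

lemma size3_shifted: "size3 (shifted N z) = N"
proof -
  have "form 0 x + form 1 x + form 2 x = 0" for x by (simp add: form_2)
  then have "(\<Sum>i<3. nform i (z, z)) = 0" by (simp add: sum_less_3 nform_def)
  moreover have "(\<Sum>i<3. N * b i) = N" using sum_b by (simp flip: sum_distrib_left)
  ultimately show ?thesis by (simp add: size3_def shifted_def sum_subtractf)
qed

text \<open>A large translation along the diagonal keeps the triangle away from both axes; the
  margin \<open>C\<close> pays for later shrinking by powers of a fixed polynomial.\<close>

lemma shifted_margin:
  obtains z where "\<And>x. x \<in> region (shifted N z) \<Longrightarrow> C \<le> x $ 1 \<and> C \<le> x $ 2"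
proof -
  define R where "R = slack * (\<Sum>i<3. \<bar>N * b i\<bar>) / \<bar>u 0 * v 1 - u 1 * v 0\<bar>"
  define z where "z = nat \<lceil>C + R\<rceil>"
  have z: "C + R \<le> real z" unfolding z_def by linarith
  have "C \<le> x $ 1 \<and> C \<le> x $ 2" if x: "x \<in> region (shifted N z)" for x
  proof -
    have "- (N * b i) \<le> form i (coords x - (real z, real z))" if "i < 3" for i
    proof -
      have "- shifted N z i \<le> form i (coords x)" using x that by (simp add: region_def)
      then show ?thesis by (simp add: shifted_def form_diff nform_def)
    qed
    from coordinate_bound[of "\<lambda>i. N * b i", OF this] show ?thesis
      using z unfolding R_def by (auto simp: coords_def abs_le_iff)
  qed
  then show thesis by (rule that)
qed

text \<open>Adding \<open>n\<close> times an exponent of \<open>f\<close> carries the shrunken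
  triangle into \<open>region e\<close>, so the margin decreases by at most that vector.\<close>

lemma region_minus_margin:
  assumes C: "\<And>x. x \<in> region e \<Longrightarrow> C \<le> x $ 1 \<and> C \<le> x $ 2" and "f \<noteq> 0" "a \<in> supp f"
    and x: "x \<in> region (\<lambda>i. e i - real n * tight f i)"
  shows "C \<le> x $ 1 + real n * real (fst a) \<and> C \<le> x $ 2 + real n * real (snd a)"
proof -
  have "- e i \<le> form i (coords (x + real n *\<^sub>R corner a))" if "i < 3" for i
  proof -
    have "- (e i - real n * tight f i) \<le> form i (coords x)"
      using x that by (simp add: region_def)
    moreover have "real n * - tight f i \<le> real n * nform i a"
      using weight_le[OF assms(3), of "nform i"] by (intro mult_left_mono) (simp_all add: tight_def)
    ultimately show ?thesis
      by (simp add: coords_add coords_scaleR form_add form_scaleR form_corner)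
  qed
  then have "x + real n *\<^sub>R corner a \<in> region e" by (simp add: region_def)
  from C[OF this] show ?thesis by simp
qed

text \<open>At the centre \<open>z\<close> all three barycentric distances equal
  \<open>size3 e / 3\<close>, so a translate of \<open>deg_below k\<close> fits there; the extra 1
  in \<open>real k + 1\<close> pays for rounding the centre.\<close>

lemma vdim_nat_region_large:
  assumes pos: "\<And>x. x \<in> region e \<Longrightarrow> 0 \<le> x $ 1 \<and> 0 \<le> x $ 2"
    and size: "size3 e \<ge> 3 * slack * (real k + 1)"
  shows "vdim (nat_region e) k + card (deg_below k) \<le> card (nat_region e)"
proof -
  have "(\<Sum>i<3. size3 e / 3 - e i) = 0" by (simp add: sum_less_3 size3_def field_simps)
  from solve_form[OF this] obtain z where z: "\<forall>i<3. form i (coords z) = size3 e / 3 - e i"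
    by blast
  have "0 \<le> 3 * slack * (real k + 1)" using slack_nonneg by simp
  then have "0 \<le> size3 e" using size by linarith
  then have "z \<in> region e" using z by (simp add: region_def)
  then have z0: "0 \<le> z $ 1" "0 \<le> z $ 2" using pos by blast+
  define c where "c = (nat \<lceil>z $ 1\<rceil>, nat \<lceil>z $ 2\<rceil>)"
  have c: "z $ 1 \<le> real (fst c)" "real (fst c) \<le> z $ 1 + 1" "z $ 2 \<le> real (snd c)" "real (snd c) \<le> z $ 2 + 1"
    unfolding c_def using z0 by (simp_all; linarith)+
  show ?thesis
  proof (rule vdim_le_if_deg_below[where c = c])
    fix a assume a: "a \<in> deg_below k"
    then have ab: "fst a < k" "snd a < k" by (auto simp: deg_below_def deg_def)
    have "- e i \<le> nform i (c + a)" if i: "i < 3" for i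
    proof -
      have "real (fst a) \<le> real k" "real (snd a) \<le> real k" using ab by simp_all
      then have "\<bar>form i (coords (corner (c + a)) - coords z)\<bar> \<le> slack * (real k + 1)"
        using c by (intro abs_form_le[OF i]) (auto simp: coords_def abs_le_iff)
      then have "form i (coords z) - slack * (real k + 1) \<le> nform i (c + a)"
        by (simp add: form_diff form_corner)
      then show ?thesis using z i size by simp
    qed
    then show "c + a \<in> nat_region e" by (simp add: nat_region_iff)
  qed simp
qed

lemma power_times_vanishing_on:
  assumes f: "f \<noteq> 0" and k: "k \<le> mult_at_1 f"
  shows "(*) (f ^ n) ` vanishing_on (nat_region (\<lambda>i. e i - real n * tight f i)) l
    \<subseteq> vanishing_on (nat_region e) (n * k + l)"
proof clarify
  fix A assume A: "A \<in> vanishing_on (nat_region (\<lambda>i. e i - real n * tight f i)) l"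
  show "f ^ n * A \<in> vanishing_on (nat_region e) (n * k + l)"
  proof (cases "A = 0")
    case True
    then show ?thesis by (simp add: vanishing_on_def polys_on_iff)
  next
    case False
    have "\<forall>i<3. tight A i \<le> e i - real n * tight f i"
      using A False by (simp add: vanishing_on_def polys_on_nat_region_iff)
    then have "f ^ n * A \<in> polys_on (nat_region e)"
      using f False by (auto simp: polys_on_nat_region_iff tight_mult tight_power)
    moreover have "vanishes_to (n * k) (f ^ n)"
      using f k by (simp add: vanishes_to_iff mult_at_1_power)
    ultimately show ?thesis
      using A by (simp add: vanishing_on_def vanishes_to_mult)
  qed
qed

text \<open>Multiples of \<open>f ^ n\<close> and of \<open>g ^ n\<close> whose cofactors supply the
  missing multiplicity lie in one space of polynomials vanishing to order
  \<open>n * (m + k)\<close>. As \<open>f\<close> is prime and does not divide \<open>g\<close>, a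
  common multiple is divisible by \<open>f ^ n * g ^ n\<close>, which bounds the
  intersection.\<close>

lemma power_ideal_dimension:
  fixes f g :: "real poly poly"
  assumes f: "prime_elem f" and g: "g \<noteq> 0" "\<not> f dvd g" and n: "n > 0"
  defines "m \<equiv> mult_at_1 f" and "k \<equiv> mult_at_1 g"
  shows "vdim (nat_region (\<lambda>i. e i - real n * tight f i)) (n * k) +
      vdim (nat_region (\<lambda>i. e i - real n * tight g i)) (n * m) \<le>
    vdim (nat_region e) (n * (m + k)) +
      card (nat_region (\<lambda>i. e i - real n * tight f i - real n * tight g i))"
proof -
  let ?Ef = "nat_region (\<lambda>i. e i - real n * tight f i)"
  let ?Eg = "nat_region (\<lambda>i. e i - real n * tight g i)"
  let ?Efg = "nat_region (\<lambda>i. e i - real n * tight f i - real n * tight g i)"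
  let ?Uf = "(*) (f ^ n) ` vanishing_on ?Ef (n * k)" and ?Ug = "(*) (g ^ n) ` vanishing_on ?Eg (n * m)"
  let ?W = "vanishing_on (nat_region e) (n * (m + k))"
  have f0: "f \<noteq> 0" using f by auto
  have Uf: "poly2.dim ?Uf = vdim ?Ef (n * k)" "poly2.fin_dim_subspace ?Uf"
    using poly2.dim_injective_image[OF fin_dim_vanishing_on linear_mult inj_on_mult] f0
    by (simp_all add: vdim_def)
  have Ug: "poly2.dim ?Ug = vdim ?Eg (n * m)" "poly2.fin_dim_subspace ?Ug"
    using poly2.dim_injective_image[OF fin_dim_vanishing_on linear_mult inj_on_mult] g
    by (simp_all add: vdim_def)
  have "?Uf \<subseteq> ?W" "?Ug \<subseteq> ?W"
    using power_times_vanishing_on[of f m n e "n * k"] power_times_vanishing_on[of g k n e "n * m"] f0 g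
    by (simp_all add: m_def k_def algebra_simps)
  then have "poly2.dim ?Uf + poly2.dim ?Ug \<le> poly2.dim ?W + poly2.dim (?Uf \<inter> ?Ug)"
    using Uf(2) Ug(2) by (intro poly2.dim_add_le_dim_Int fin_dim_vanishing_on)
      (simp_all add: poly2.fin_dim_subspace_def)
  moreover have "poly2.dim (?Uf \<inter> ?Ug) \<le> card ?Efg"
  proof -
    have Q: "poly2.dim ((*) (f ^ n * g ^ n) ` polys_on ?Efg) = card ?Efg"
      "poly2.fin_dim_subspace ((*) (f ^ n * g ^ n) ` polys_on ?Efg)"
      using poly2.dim_injective_image[OF fin_dim_polys_on linear_mult inj_on_mult] f0 g
      by (simp_all add: dim_polys_on)
    have "?Uf \<inter> ?Ug \<subseteq> (*) (f ^ n * g ^ n) ` polys_on ?Efg"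
    proof
      fix h assume "h \<in> ?Uf \<inter> ?Ug"
      then obtain A B where h: "h = f ^ n * A" "h = g ^ n * B" and B: "B \<in> vanishing_on ?Eg (n * m)"
        by blast
      have "\<not> f dvd g ^ n" using f g(2) prime_elem_dvd_power by blast
      moreover have "f ^ n dvd g ^ n * B" using h by (metis dvd_triv_left)
      ultimately obtain q where q: "B = f ^ n * q"
        using prime_power_dvd_multD[OF f _ n, of "g ^ n" B] by blast
      have "q \<in> polys_on ?Efg"
      proof (cases "q = 0")
        case True
        then show ?thesis by (simp add: polys_on_iff)
      next
        case False
        then have "B \<noteq> 0" using q f0 by simp
        then have "\<forall>i<3. tight B i \<le> e i - real n * tight g i"
          using B by (simp add: vanishing_on_def polys_on_nat_region_iff)
        moreover have "tight B i = real n * tight f i + tight q i" for i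
          using q f0 False by (simp add: tight_mult tight_power)
        ultimately show ?thesis using False by (simp add: polys_on_nat_region_iff algebra_simps)
      qed
      then show "h \<in> (*) (f ^ n * g ^ n) ` polys_on ?Efg"
        using h q by (auto simp: mult_ac)
    qed
    from poly2.dim_mono_fin_dim[OF Q(2) this] show ?thesis by (simp only: Q(1))
  qed
  ultimately show ?thesis using Uf(1) Ug(1) by (simp add: vdim_def)
qed

text \<open>Powers of \<open>f\<close> and \<open>g\<close> are used because lattice points are counted only up to an error that is
  linear in the size of the region; this error becomes negligible as \<open>n\<close> grows.\<close>

lemma power_mult_bound:
  fixes f g :: "real poly poly"
  assumes f: "prime_elem f" and g: "g \<noteq> 0" "\<not> f dvd g" and n: "n > 0"
  defines "m \<equiv> real (mult_at_1 f)" and "k \<equiv> real (mult_at_1 g)"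
  defines "\<kappa> \<equiv> tau f + tau g + 3 * slack * (m + k + 2)"
  shows "m * k \<le> 2 * vol * tau f * tau g + 24 * slack * \<kappa> * vol / real n"
proof -
  have f0: "f \<noteq> 0" using f by auto
  obtain af where af: "af \<in> supp f" using f0 supp_eq_empty_iff by blast
  obtain ag where ag: "ag \<in> supp g" using g supp_eq_empty_iff by blast
  \<comment> \<open>Room for removing \<open>n\<close> times an exponent of \<open>f\<close> or of
    \<open>g\<close> while staying in the quadrant.\<close>
  define C where "C = real n * (real (fst af) + real (snd af) + real (fst ag) + real (snd ag))"
  have C0: "C \<ge> 0" by (simp add: C_def)
  \<comment> \<open>\<open>\<kappa>\<close> is large enough for the jets of order
    \<open>n * (m + k)\<close> to be independent on the triangle and for the shrunken triangles to
    keep the size that the lattice point counts require.\<close>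
  define N where "N = \<kappa> * real n"
  obtain z where z: "\<And>x. x \<in> region (shifted N z) \<Longrightarrow> C \<le> x $ 1 \<and> C \<le> x $ 2"
    using shifted_margin by blast
  define e where "e = shifted N z"
  have size: "size3 e = N" by (simp add: e_def size3_shifted)
  define t where "t = tau f"
  define s where "s = tau g"
  have ts: "t \<ge> 0" "s \<ge> 0" using tau_nonneg f0 g by (simp_all add: t_def s_def)
  have mk: "m \<ge> 0" "k \<ge> 0" by (simp_all add: m_def k_def)
  have n1: "real n \<ge> 1" using n by simp
  have sz: "size3 (\<lambda>i. e i - real n * tight f i) = N - real n * t"
    "size3 (\<lambda>i. e i - real n * tight g i) = N - real n * s"
    "size3 (\<lambda>i. e i - real n * tight f i - real n * tight g i) = N - real n * t - real n * s"
    by (simp_all add: size3_diff size3_scale size t_def s_def tau_def)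
  let ?cf = "real (card (nat_region (\<lambda>i. e i - real n * tight f i)))"
  let ?cg = "real (card (nat_region (\<lambda>i. e i - real n * tight g i)))"
  let ?cfg = "real (card (nat_region (\<lambda>i. e i - real n * tight f i - real n * tight g i)))"
  let ?c = "real (card (nat_region e))"
  have slack_n: "slack \<le> slack * real n" using slack_nonneg n1 by (simp add: mult_le_cancel_left1)
  have smk: "0 \<le> slack * real n * (m + k)" using slack_nonneg mk by simp
  have N_eq: "N = t * real n + s * real n + 3 * (slack * real n * (m + k)) + 6 * (slack * real n)"
    by (simp add: N_def \<kappa>_def t_def s_def algebra_simps)
  have tn: "0 \<le> t * real n" "0 \<le> s * real n" using ts by simp_all
  have M: "real (n * (mult_at_1 f + mult_at_1 g)) = real n * (m + k)"
    by (simp add: m_def k_def)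
  have cof: "?cf \<ge> vol * (N - real n * t - 3 * slack)\<^sup>2"
  proof -
    have "x $ 1 \<ge> 0 \<and> x $ 2 \<ge> 0" if "x \<in> region (\<lambda>i. e i - real n * tight f i)" for x
      using region_minus_margin[OF z[folded e_def] f0 af that] unfolding C_def
      by (auto simp: algebra_simps intro: order_trans[rotated] add_nonneg_nonneg)
    then show ?thesis
      using card_nat_region_ge[of "\<lambda>i. e i - real n * tight f i"] sz N_eq slack_n smk tn slack_nonneg
      by (simp add: mult.commute)
  qed
  have cog: "?cg \<ge> vol * (N - real n * s - 3 * slack)\<^sup>2"
  proof -
    have "x $ 1 \<ge> 0 \<and> x $ 2 \<ge> 0" if "x \<in> region (\<lambda>i. e i - real n * tight g i)" for x
      using region_minus_margin[OF z[folded e_def] g(1) ag that] unfolding C_def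
      by (auto simp: algebra_simps intro: order_trans[rotated] add_nonneg_nonneg)
    then show ?thesis
      using card_nat_region_ge[of "\<lambda>i. e i - real n * tight g i"] sz N_eq slack_n smk tn slack_nonneg
      by (simp add: mult.commute)
  qed
  have cofg: "?cfg \<le> vol * (N - real n * t - real n * s + 3 * slack)\<^sup>2"
    using card_nat_region_le[of "\<lambda>i. e i - real n * tight f i - real n * tight g i"]
      sz N_eq slack_n smk tn slack_nonneg by (simp add: mult.commute)
  have co: "?c \<le> vol * (N + 3 * slack)\<^sup>2"
    using card_nat_region_le[of e] size N_eq slack_n smk tn slack_nonneg by simp
  have "vdim (nat_region e) (n * (mult_at_1 f + mult_at_1 g)) +
      card (deg_below (n * (mult_at_1 f + mult_at_1 g))) \<le> card (nat_region e)"
  proof (rule vdim_nat_region_large)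
    show "0 \<le> x $ 1 \<and> 0 \<le> x $ 2" if "x \<in> region e" for x
      using z[folded e_def, OF that] C0 by linarith
    show "3 * slack * (real (n * (mult_at_1 f + mult_at_1 g)) + 1) \<le> size3 e"
      unfolding M size using N_eq slack_n tn slack_nonneg by (simp add: algebra_simps)
  qed
  moreover have "card (nat_region (\<lambda>i. e i - real n * tight f i)) \<le>
      vdim (nat_region (\<lambda>i. e i - real n * tight f i)) (n * mult_at_1 g) + card (deg_below (n * mult_at_1 g))"
    "card (nat_region (\<lambda>i. e i - real n * tight g i)) \<le>
      vdim (nat_region (\<lambda>i. e i - real n * tight g i)) (n * mult_at_1 f) + card (deg_below (n * mult_at_1 f))"
    by (intro card_le_vdim finite_nat_region)+
  moreover note power_ideal_dimension[OF f g n, of e]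
  ultimately have "?cf + ?cg + real (card (deg_below (n * (mult_at_1 f + mult_at_1 g)))) \<le>
    ?c + ?cfg + real (card (deg_below (n * mult_at_1 g))) + real (card (deg_below (n * mult_at_1 f)))"
    by linarith
  \<comment> \<open>The linear parts of the three triangular numbers cancel, leaving the mixed term
    of a square.\<close>
  moreover have "real (card (deg_below (n * (mult_at_1 f + mult_at_1 g)))) -
      real (card (deg_below (n * mult_at_1 g))) - real (card (deg_below (n * mult_at_1 f))) =
      (real n)\<^sup>2 * (m * k)"
    unfolding card_deg_below_real
    by (simp add: m_def k_def power2_eq_square field_simps)
  ultimately have "(real n)\<^sup>2 * (m * k) \<le> vol * (N + 3 * slack)\<^sup>2 + vol * (N - real n * t - real n * s + 3 * slack)\<^sup>2
     - vol * (N - real n * t - 3 * slack)\<^sup>2 - vol * (N - real n * s - 3 * slack)\<^sup>2"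
    using cof cog cofg co by linarith
  \<comment> \<open>Expanding the four squares leaves a mixed area as the only main term; each
    square contributes an error \<open>6 * slack * N\<close> to leading order, whence the
    24.\<close>
  also have "\<dots> = vol * (2 * (real n)\<^sup>2 * t * s + 24 * slack * N - 12 * slack * (real n * t + real n * s))"
    by (simp add: power2_eq_square algebra_simps)
  also have "\<dots> \<le> vol * (2 * (real n)\<^sup>2 * t * s + 24 * slack * N)"
    using vol_pos ts slack_nonneg by (intro mult_left_mono) simp_all
  also have "\<dots> = (real n)\<^sup>2 * (2 * vol * t * s + 24 * slack * \<kappa> * vol / real n)"
    using n1 by (simp add: N_def power2_eq_square field_simps)
  finally show ?thesis
    using n1 unfolding t_def s_def by (subst (asm) mult_le_cancel_left_pos) simp_all
qed

text \<open>A Bernstein inequality: the number of common zeros of \<open>f\<close> and \<open>g\<close>, which is at least the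
  product of the multiplicities at \<open>(1, 1)\<close>, is at most the mixed volume.\<close>

lemma mult_at_1_mult_le:
  fixes f g :: "real poly poly"
  assumes "prime_elem f" "g \<noteq> 0" "\<not> f dvd g"
  shows "real (mult_at_1 f) * real (mult_at_1 g) \<le> 2 * vol * tau f * tau g"
proof -
  define K where "K = 24 * slack * (tau f + tau g + 3 * slack * (real (mult_at_1 f) + real (mult_at_1 g) + 2)) * vol"
  have "\<forall>\<^sub>F n in sequentially. real (mult_at_1 f) * real (mult_at_1 g) \<le> 2 * vol * tau f * tau g + K / real n"
    using power_mult_bound[OF assms] unfolding K_def
    by (intro eventually_sequentiallyI[of 1]) simp
  moreover have "(\<lambda>n. 2 * vol * tau f * tau g + K / real n) \<longlonglongrightarrow> 2 * vol * tau f * tau g + 0"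
    by (intro tendsto_intros lim_const_over_n)
  ultimately show ?thesis
    using tendsto_lowerbound by fastforce
qed

end

section \<open>The two thresholds\<close>

context barycentric
begin

text \<open>Both invariants are additive, so the inequality passes from primes to products; for
  units additivity and nonnegativity force both to be zero.\<close>

lemma mult_at_1_le_if_primes:
  assumes primes: "\<And>p. prime p \<Longrightarrow> real (mult_at_1 p) \<le> w * tau p" and "g \<noteq> 0"
  shows "real (mult_at_1 g) \<le> w * tau g"
  using assms(2)
proof (induction g rule: prime_divisors_induct)
  case zero
  then show ?case by simp
next
  case (unit g)
  then obtain h where h: "g * h = 1" by (metis dvdE)
  then have nz: "g \<noteq> 0" "h \<noteq> 0" by auto
  have "mult_at_1 g + mult_at_1 h = 0" "tau g + tau h = 0"
    using mult_at_1_mult[OF nz] tau_mult[OF nz] h by simp_all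
  moreover from this have "tau g = 0"
    using tau_nonneg[OF nz(1)] tau_nonneg[OF nz(2)] by linarith
  ultimately show ?case by simp
next
  case (factor p g)
  then have nz: "p \<noteq> 0" "g \<noteq> 0" by auto
  then show ?case
    using factor.IH primes[OF factor.hyps] by (simp add: mult_at_1_mult tau_mult algebra_simps)
qed

lemma vdim_eq_0_if_ratio:
  assumes ratio: "\<And>g. g \<noteq> 0 \<Longrightarrow> real (mult_at_1 g) \<le> w * tau g" and w: "w \<ge> 0"
    and k: "w * size3 e < real k"
  shows "vdim (nat_region e) k = 0"
  unfolding vdim_eq_0_iff[OF finite_nat_region]
proof
  fix g assume g: "g \<in> vanishing_on (nat_region e) k"
  have "g = 0"
  proof (rule ccontr)
    assume nz: "g \<noteq> 0"
    have "real k \<le> real (mult_at_1 g)"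
      using g nz by (simp add: vanishing_on_def vanishes_to_iff)
    also have "\<dots> \<le> w * tau g" using ratio nz by blast
    also have "\<dots> \<le> w * size3 e"
      using g nz w by (intro mult_left_mono tau_le_size3) (simp_all add: vanishing_on_def)
    finally show False using k by simp
  qed
  then show "g \<in> {0}" by simp
qed

text \<open>Independence of all conditions for order \<open>k\<close> includes that of the last
  \<open>k\<close> ones, on the Taylor coefficients of degree \<open>k - 1\<close>.\<close>

lemma vdim_drop:
  assumes "vdim E k + card (deg_below k) \<le> card E" "finite E" "k > 0"
  shows "vdim E k + k \<le> vdim E (k - 1)"
proof -
  have "card E \<le> vdim E (k - 1) + card (deg_below (k - 1))"
    by (rule card_le_vdim[OF assms(2)])
  moreover have "2 * card (deg_below k) = 2 * card (deg_below (k - 1)) + 2 * k"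
    using assms(3) unfolding card_deg_below by (cases k) simp_all
  ultimately show ?thesis using assms(1) by simp
qed

text \<open>If \<open>tau f = 0\<close>, the enclosing triangle is a point, so \<open>f\<close> is a
  monomial and does not vanish at (1, 1).\<close>

lemma mult_at_1_pos_imp_tau_pos:
  assumes "f \<noteq> 0" "mult_at_1 f > 0"
  shows "tau f > 0"
proof (rule ccontr)
  assume "\<not> tau f > 0"
  then have t0: "tau f = 0" using tau_nonneg[OF assms(1)] by simp
  have eq: "form i (real (fst a), real (snd a)) = - tight f i" if a: "a \<in> supp f" and i: "i < 3" for a i
  proof -
    have "- tight f j \<le> nform j a" for j using weight_le[OF a, of "nform j"] by (simp add: tight_def)
    then have "- tight f 0 \<le> nform 0 a" "- tight f 1 \<le> nform 1 a" "- tight f 2 \<le> nform 2 a" by blast+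
    then have "\<forall>i<3. nform i a = - tight f i"
      using t0 unfolding tau_def size3_def sum_less_3 all_less_3 nform_def form_2 by linarith
    then show ?thesis using i by (simp add: nform_def)
  qed
  obtain a where a: "a \<in> supp f" using assms(1) supp_eq_empty_iff by blast
  have "a' = a" if "a' \<in> supp f" for a'
  proof -
    let ?x = "(real (fst a), real (snd a)) - (real (fst a'), real (snd a'))"
    have "form i ?x = 0" if "i < 3" for i
      using eq[OF a that] eq[OF \<open>a' \<in> supp f\<close> that] unfolding form_diff by simp
    then have "\<bar>fst ?x\<bar> \<le> 0" "\<bar>snd ?x\<bar> \<le> 0"
      using coordinate_bound[of "\<lambda>_. 0" ?x] by simp_all
    then show ?thesis by (simp add: prod_eq_iff)
  qed
  then have "supp f = {a}" using a by blast
  then have "coeff2 (shift f) 0 = coeff2 f a" by (simp add: coeff2_shift)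
  also have "\<dots> \<noteq> 0" using a by (simp add: supp_def)
  finally have "\<not> vanishes_to 1 f"
    unfolding vanishes_to_def by (intro notI) (auto simp: deg_def zero_prod_def)
  then show False using assms by (simp add: vanishes_to_iff)
qed

end

text \<open>\<open>lam\<close> and \<open>w\<close> are the Seshadri constant and the pseudo-effective threshold of the
  triangle at \<open>(1, 1)\<close>.\<close>

locale thresholds = barycentric +
  fixes lam w C :: real
  assumes lam_pos: "lam > 0" and lam_le_w: "lam \<le> w" and lam_w: "lam * w = 2 * vol"
    and ratio: "\<And>g. g \<noteq> 0 \<Longrightarrow> real (mult_at_1 g) \<le> w * tau g"
    and vdim_upper: "\<And>e k. 0 \<le> size3 e \<Longrightarrow> lam * size3 e < real k \<Longrightarrow>
      real (vdim (nat_region e) k) \<le> lam * (w - lam) / 2 * (size3 e)\<^sup>2 + C * size3 e + C"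
    and full_jets: "\<And>e k. vdim (nat_region e) k + card (deg_below k) \<le> card (nat_region e) \<Longrightarrow>
      k > 0 \<Longrightarrow> real k - 1 \<le> lam * size3 e"
    and vdim_zero: "\<And>N. \<exists>c\<ge>0. \<forall>e k. size3 e = N \<longrightarrow> (\<forall>x\<in>region e. c \<le> x $ 1 \<and> c \<le> x $ 2) \<longrightarrow>
      vdim (nat_region e) k = 0 \<longrightarrow> w * N - C \<le> real k"

section \<open>Existence of the two thresholds\<close>

context barycentric
begin

text \<open>Beyond order \<open>w * size3 e\<close> only the zero polynomial is left, which gives
  the upper bounds; up to an order close to it there are more lattice points than conditions,
  because \<open>w * w = 2 * vol\<close>.\<close>

lemma thresholds_if_no_negative_curve:
  assumes primes: "\<And>p. prime p \<Longrightarrow> real (mult_at_1 p) \<le> sqrt (2 * vol) * tau p"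
  shows "thresholds u v b (sqrt (2 * vol)) (sqrt (2 * vol)) (3 * slack * sqrt (2 * vol) + 1)"
proof -
  define w where "w = sqrt (2 * vol)"
  have w: "w > 0" "w * w = 2 * vol" using vol_pos by (simp_all add: w_def)
  have ratio: "real (mult_at_1 g) \<le> w * tau g" if "g \<noteq> 0" for g
    using mult_at_1_le_if_primes[OF primes that] by (simp add: w_def)
  have C: "3 * slack * w + 1 \<ge> 0" using w slack_nonneg by simp
  have "thresholds u v b w w (3 * slack * w + 1)"
  proof unfold_locales
    show "real (vdim (nat_region e) k) \<le>
        w * (w - w) / 2 * (size3 e)\<^sup>2 + (3 * slack * w + 1) * size3 e + (3 * slack * w + 1)"
      if "0 \<le> size3 e" "w * size3 e < real k" for e k
      using vdim_eq_0_if_ratio[OF ratio _ that(2)] that(1) w(1) C by simp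
    show "real k - 1 \<le> w * size3 e"
      if "vdim (nat_region e) k + card (deg_below k) \<le> card (nat_region e)" "k > 0" for e k
    proof (rule ccontr)
      assume "\<not> real k - 1 \<le> w * size3 e"
      \<comment> \<open>Nothing is left at order \<open>k - 1\<close>, so the next
        \<open>k > 0\<close> conditions cannot be independent.\<close>
      then have "vdim (nat_region e) (k - 1) = 0"
        using w \<open>k > 0\<close> by (intro vdim_eq_0_if_ratio[OF ratio]) (simp_all add: of_nat_diff)
      then show False using vdim_drop[OF that(1) _ that(2)] that(2) by simp
    qed
    show "\<exists>c\<ge>0. \<forall>e k. size3 e = N \<longrightarrow> (\<forall>x\<in>region e. c \<le> x $ 1 \<and> c \<le> x $ 2) \<longrightarrow>
        vdim (nat_region e) k = 0 \<longrightarrow> w * N - (3 * slack * w + 1) \<le> real k" for N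
    proof (intro exI[of _ 0] conjI allI impI)
      fix e k assume e: "size3 e = N" "\<forall>x\<in>region e. 0 \<le> x $ 1 \<and> 0 \<le> x $ 2"
        and z: "vdim (nat_region e) k = 0"
      show "w * N - (3 * slack * w + 1) \<le> real k"
      proof (cases "3 * slack \<le> N")
        case True
        have "(w * (N - 3 * slack))\<^sup>2 = (w * w) * (N - 3 * slack)\<^sup>2"
          by (simp add: power2_eq_square)
        also have "\<dots> = 2 * (vol * (N - 3 * slack)\<^sup>2)" by (simp only: w(2) mult.assoc)
        also have "\<dots> \<le> 2 * real (card (nat_region e))"
          using card_nat_region_ge[of e] True e by simp
        also have "\<dots> \<le> 2 * real (card (deg_below k))"
          using card_le_vdim[OF finite_nat_region, of e k] z by simp
        also have "\<dots> = real k * (real k + 1)" by (simp add: card_deg_below_real)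
        also have "\<dots> \<le> (real k + 1)\<^sup>2" by (simp add: power2_eq_square algebra_simps)
        finally have "w * (N - 3 * slack) \<le> real k + 1"
          by (rule power2_le_imp_le) simp
        then show ?thesis by (simp add: algebra_simps)
      next
        case False
        then have "w * N \<le> w * (3 * slack)" using w by (intro mult_left_mono) auto
        then show ?thesis by (simp add: algebra_simps)
      qed
    qed simp
  qed (use w ratio in auto)
  then show ?thesis by (simp add: w_def)
qed

text \<open>Beyond this threshold the intersection inequality forces \<open>f\<close> to divide
  every element, and multiplication by \<open>f\<close> is an isomorphism of the two spaces. For
  \<open>k < mult_at_1 f\<close> the truncated difference is 0: the cofactor is then
  unconstrained.\<close>

lemma vdim_divide:
  assumes f: "prime_elem f" "mult_at_1 f > 0"
    and k: "2 * vol * tau f / real (mult_at_1 f) * size3 e < real k"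
  shows "vdim (nat_region e) k = vdim (nat_region (\<lambda>i. e i - tight f i)) (k - mult_at_1 f)"
proof -
  have f0: "f \<noteq> 0" using f by auto
  have "vanishing_on (nat_region e) k =
    (*) f ` vanishing_on (nat_region (\<lambda>i. e i - tight f i)) (k - mult_at_1 f)"
  proof (intro equalityI subsetI)
    fix g assume g: "g \<in> vanishing_on (nat_region e) k"
    show "g \<in> (*) f ` vanishing_on (nat_region (\<lambda>i. e i - tight f i)) (k - mult_at_1 f)"
    proof (cases "g = 0")
      case True
      then show ?thesis
        using poly2.subspace_0[OF subspace_vanishing_on] by (intro image_eqI[of _ _ 0]) simp_all
    next
      case False
      have kg: "k \<le> mult_at_1 g" and tg: "\<forall>i<3. tight g i \<le> e i"
        using g False by (simp_all add: vanishing_on_def vanishes_to_iff polys_on_nat_region_iff)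
      have "f dvd g"
      proof (rule ccontr)
        assume "\<not> f dvd g"
        then have "real (mult_at_1 f) * real (mult_at_1 g) \<le> 2 * vol * tau f * tau g"
          using mult_at_1_mult_le f False by blast
        also have "\<dots> \<le> 2 * vol * tau f * size3 e"
          using tau_le_size3[of g e] g False vol_pos tau_nonneg[OF f0]
          by (intro mult_left_mono) (simp_all add: vanishing_on_def)
        finally have "real (mult_at_1 g) \<le> 2 * vol * tau f / real (mult_at_1 f) * size3 e"
          using f(2) by (simp add: field_simps)
        then show False using k kg by simp
      qed
      then obtain q where q: "g = f * q" by blast
      then have q0: "q \<noteq> 0" using False by auto
      have "q \<in> vanishing_on (nat_region (\<lambda>i. e i - tight f i)) (k - mult_at_1 f)"
        using tg kg q q0 f0
        by (auto simp: vanishing_on_def polys_on_nat_region_iff vanishes_to_iff tight_mult mult_at_1_mult algebra_simps)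
      then show ?thesis using q by blast
    qed
  next
    fix g assume "g \<in> (*) f ` vanishing_on (nat_region (\<lambda>i. e i - tight f i)) (k - mult_at_1 f)"
    then have "g \<in> vanishing_on (nat_region e) (mult_at_1 f + (k - mult_at_1 f))"
      using power_times_vanishing_on[OF f0 order_refl, of 1 e "k - mult_at_1 f"] by auto
    then show "g \<in> vanishing_on (nat_region e) k"
      by (auto simp: vanishing_on_def elim: vanishes_to_mono)
  qed
  then show ?thesis
    using poly2.dim_injective_image[OF fin_dim_vanishing_on linear_mult inj_on_mult] f0
    by (simp add: vdim_def)
qed

text \<open>The hypothesis \<open>neg\<close> says that \<open>f\<close> defines a curve of negative self-intersection on the
  blow-up at \<open>(1, 1)\<close> of the toric surface of the triangle.\<close>

lemma thresholds_if_negative_curve: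
  assumes f: "prime f" and neg: "real (mult_at_1 f) > sqrt (2 * vol) * tau f"
  obtains lam w C where "thresholds u v b lam w C"
proof -
  define m where "m = mult_at_1 f"
  define t where "t = tau f"
  have pf: "prime_elem f" and f0: "f \<noteq> 0" using f by auto
  have "0 \<le> sqrt (2 * vol) * tau f" using tau_nonneg[OF f0] vol_pos by simp
  then have m: "m > 0" using neg by (simp add: m_def)
  then have t: "t > 0" using mult_at_1_pos_imp_tau_pos[OF f0] by (simp add: m_def t_def)
  define w where "w = real m / t"
  define lam where "lam = 2 * vol * t / real m"
  have w: "w > 0" "w * t = real m" and lam: "lam > 0" "lam * w = 2 * vol"
    using m t vol_pos by (simp_all add: w_def lam_def)
  have "sqrt (2 * vol) < w"
    using neg t by (simp add: w_def m_def t_def pos_less_divide_eq)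
  then have "(sqrt (2 * vol))\<^sup>2 < w\<^sup>2"
    using vol_pos by (intro power_strict_mono) simp_all
  then have "lam * w < w * w"
    using lam vol_pos by (simp add: power2_eq_square)
  then have lw: "lam < w" using w by simp
  have ratio: "real (mult_at_1 g) \<le> w * tau g" if "g \<noteq> 0" for g
  proof (rule mult_at_1_le_if_primes[OF _ that])
    fix p :: "real poly poly" assume p: "prime p"
    then have p0: "p \<noteq> 0" by auto
    show "real (mult_at_1 p) \<le> w * tau p"
    proof (cases "f dvd p")
      case True
      then have "f = p" using f p primes_dvd_imp_eq by blast
      then show ?thesis using w by (simp add: m_def t_def)
    next
      case False
      have "real m * real (mult_at_1 p) \<le> real m * (lam * tau p)"
        using mult_at_1_mult_le[OF pf p0 False] m by (simp add: m_def t_def lam_def)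
      then have "real (mult_at_1 p) \<le> lam * tau p" using m by simp
      also have "\<dots> \<le> w * tau p" using lw tau_nonneg[OF p0] by (intro mult_right_mono) simp_all
      finally show ?thesis .
    qed
  qed
  have divide: "vdim (nat_region e) k = vdim (nat_region (\<lambda>i. e i - tight f i)) (k - m)"
    if "lam * size3 e < real k" for e k
    using vdim_divide[OF pf, of e k] m that by (simp add: m_def t_def lam_def)
  have size_f: "size3 (\<lambda>i. e i - tight f i) = size3 e - t" for e
    by (simp add: size3_diff t_def tau_def)
  \<comment> \<open>If \<open>k \<le> lam * size3 e\<close> and \<open>y = w * size3 e - k\<close>,
    then \<open>k \<le> K0 * y\<close>, so the cost of one more order is bounded in terms of
    \<open>y\<close> alone.\<close>
  define K0 where "K0 = lam / (w - lam)"
  have K0: "K0 > 0" using lam lw by (simp add: K0_def)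
  \<comment> \<open>Chosen to satisfy the recurrence \<open>G_step\<close>; the constant term
    \<open>K0 + 1\<close> covers \<open>y < 1\<close>.\<close>
  define G where "G y = K0 / 2 * y\<^sup>2 + (1 + K0 / 2) * y + (K0 + 1)" for y
  have G_mono: "G x \<le> G y" if "0 \<le> x" "x \<le> y" for x y
    unfolding G_def using K0 that by (intro add_mono mult_left_mono power_mono) simp_all
  have G_pos: "0 \<le> G y" if "0 \<le> y" for y
    unfolding G_def using K0 that by simp
  have G_step: "G (y - 1) + (K0 * y + 1) = G y" for y
  proof -
    obtain h where "K0 = 2 * h" by (metis mult.commute nonzero_divide_eq_eq zero_neq_numeral)
    then show ?thesis by (simp add: G_def power2_eq_square algebra_simps)
  qed
  \<comment> \<open>\<open>G\<close> is a function of \<open>w * size3 e - k\<close> only, a quantity that is unchanged when one divides by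
    \<open>f\<close> (which is possible for \<open>k > lam * size3 e\<close>). For smaller \<open>k\<close> the bound comes from \<open>k + 1\<close>.\<close>
  have vdim_G: "real (vdim (nat_region e) k) \<le> G (max 0 (w * size3 e - real k))"
    if "size3 e + (w * size3 e - real k) < real n * min 1 t" for n e k
    using that
  \<comment> \<open>Dividing by \<open>f\<close> lowers \<open>size3 e\<close> by \<open>t\<close>
    without raising \<open>y\<close>, and passing to \<open>k + 1\<close> lowers \<open>y\<close> by
    1; the sum of both thus drops by at least \<open>min 1 t\<close>.\<close>
  proof (induction n arbitrary: e k)
    case 0
    then have "size3 e < 0 \<or> w * size3 e < real k" by auto
    then have "vdim (nat_region e) k = 0"
    proof
      assume "size3 e < 0"
      then have "w * size3 e < 0" using w by (simp add: mult_less_0_iff)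
      then show ?thesis using w by (intro vdim_eq_0_if_ratio[OF ratio]) simp_all
    qed (use w vdim_eq_0_if_ratio[OF ratio] in simp)
    then show ?case using G_pos by simp
  next
    case (Suc n)
    define y where "y = w * size3 e - real k"
    have hyp: "size3 e + y < real n * min 1 t + min 1 t"
      using Suc.prems by (simp add: y_def algebra_simps)
    show ?case
    proof (cases "y < 0")
      case True
      then have "vdim (nat_region e) k = 0"
        using w by (intro vdim_eq_0_if_ratio[OF ratio]) (simp_all add: y_def)
      then show ?thesis using G_pos by simp
    next
      case y0: False
      show ?thesis
      proof (cases "lam * size3 e < real k")
        case True
        have "w * size3 e - real m - real (k - m) \<le> y" unfolding y_def by linarith
        then have y': "w * (size3 e - t) - real (k - m) \<le> y"
          using w by (simp add: algebra_simps)
        have "real (vdim (nat_region (\<lambda>i. e i - tight f i)) (k - m)) \<le> G (max 0 (w * (size3 e - t) - real (k - m)))"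
          using Suc.IH[of "\<lambda>i. e i - tight f i" "k - m"] y' hyp by (simp add: size_f)
        also have "\<dots> \<le> G y" using y' y0 by (intro G_mono) auto
        finally show ?thesis using divide[OF True] y0 by (simp add: y_def)
      next
        case False
        have "(w - lam) * size3 e \<le> y" using False by (simp add: y_def algebra_simps)
        then have "size3 e \<le> y / (w - lam)" using lw by (simp add: pos_le_divide_eq mult.commute)
        then have "lam * size3 e \<le> lam * (y / (w - lam))" using lam by (intro mult_left_mono) auto
        then have k: "real k \<le> K0 * y" using False by (simp add: K0_def)
        have IH: "real (vdim (nat_region e) (k + 1)) \<le> G (max 0 (y - 1))"
          using Suc.IH[of e "k + 1"] hyp by (simp add: y_def algebra_simps)
        have step: "real (vdim (nat_region e) k) \<le> real (vdim (nat_region e) (k + 1)) + (real k + 1)"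
          using vdim_step[OF finite_nat_region, of e k] by linarith
        show ?thesis
        proof (cases "y < 1")
          case True
          then have "vdim (nat_region e) (k + 1) = 0"
            using w by (intro vdim_eq_0_if_ratio[OF ratio]) (simp_all add: y_def)
          moreover have "K0 * y \<le> K0 * 1" using True K0 by (intro mult_left_mono) auto
          ultimately have "real (vdim (nat_region e) k) \<le> K0 + 1" using step k by simp
          also have "\<dots> \<le> G y" unfolding G_def using K0 y0 by simp
          finally show ?thesis using y0 by (simp add: y_def)
        next
          case y1: False
          then have "real (vdim (nat_region e) k) \<le> G (y - 1) + (K0 * y + 1)"
            using IH step k by simp
          also have "\<dots> = G y" by (rule G_step)
          finally show ?thesis using y0 by (simp add: y_def)
        qed
      qed
    qed
  qed
  \<comment> \<open>By the lower count a triangle in the quadrant of at least this size contains a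
    lattice point.\<close>
  define c0 where "c0 = 3 * slack + 1"
  have c0: "c0 > 0" using slack_nonneg by (simp add: c0_def)
  define C where "C = (1 + K0 / 2) * (w - lam) + (K0 + 1) + w * c0 + real m"
  have C: "(1 + K0 / 2) * (w - lam) \<le> C" "K0 + 1 \<le> C" "w * c0 + real m \<le> C"
    using K0 lw w c0 by (simp_all add: C_def)
  have "thresholds u v b lam w C"
  proof unfold_locales
    show "real (vdim (nat_region e) k) \<le> lam * (w - lam) / 2 * (size3 e)\<^sup>2 + C * size3 e + C"
      if e: "0 \<le> size3 e" and k: "lam * size3 e < real k" for e k
    proof -
      have "min 1 t > 0" using t by simp
      then obtain n where "size3 e + (w * size3 e - real k) < real n * min 1 t"
        using reals_Archimedean3 by blast
      from vdim_G[OF this] have "real (vdim (nat_region e) k) \<le> G (max 0 (w * size3 e - real k))" .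
      also have "\<dots> \<le> G ((w - lam) * size3 e)"
      proof (rule G_mono)
        have "lam * size3 e \<le> w * size3 e" using lw e by (intro mult_right_mono) auto
        then show "max 0 (w * size3 e - real k) \<le> (w - lam) * size3 e"
          using k by (simp add: left_diff_distrib)
      qed simp
      also have "\<dots> = lam * (w - lam) / 2 * (size3 e)\<^sup>2 + (1 + K0 / 2) * (w - lam) * size3 e + (K0 + 1)"
      proof -
        have Kw: "lam = K0 * (w - lam)" using lw by (simp add: K0_def)
        have "K0 / 2 * ((w - lam) * size3 e)\<^sup>2 = K0 * (w - lam) * (w - lam) / 2 * (size3 e)\<^sup>2"
          by (simp add: power2_eq_square)
        also have "\<dots> = lam * (w - lam) / 2 * (size3 e)\<^sup>2" by (simp only: Kw[symmetric])
        finally show ?thesis by (simp add: G_def)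
      qed
      also have "\<dots> \<le> lam * (w - lam) / 2 * (size3 e)\<^sup>2 + C * size3 e + C"
        using C e by (intro add_mono mult_right_mono) simp_all
      finally show ?thesis .
    qed
    show "real k - 1 \<le> lam * size3 e"
      if full: "vdim (nat_region e) k + card (deg_below k) \<le> card (nat_region e)" and k: "k > 0" for e k
    proof (rule ccontr)
      assume "\<not> real k - 1 \<le> lam * size3 e"
      then have "lam * size3 e < real (k - 1)" "lam * size3 e < real k"
        using k by (simp_all add: of_nat_diff)
      note d = divide[OF this(1)] divide[OF this(2)]
      let ?E = "nat_region (\<lambda>i. e i - tight f i)"
      \<comment> \<open>Both orders are beyond the threshold. After division by \<open>f\<close> the
        drop happens between the orders \<open>k - 1 - m\<close> and \<open>k - m\<close>, where at
        most \<open>k - m < k\<close> new conditions are available.\<close>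
      have drop: "vdim ?E (k - m) + k \<le> vdim ?E (k - 1 - m)"
        using vdim_drop[OF full finite_nat_region k] d by simp
      show False
      proof (cases "m < k")
        case True
        then have "k - m = k - 1 - m + 1" by simp
        then have "vdim ?E (k - 1 - m) \<le> vdim ?E (k - m) + (k - m)"
          using vdim_step[OF finite_nat_region, of "\<lambda>i. e i - tight f i" "k - 1 - m"] by simp
        then show False using drop m True by simp
      next
        case False
        then show False using drop k by simp
      qed
    qed
    show "\<exists>c\<ge>0. \<forall>e k. size3 e = N \<longrightarrow> (\<forall>x\<in>region e. c \<le> x $ 1 \<and> c \<le> x $ 2) \<longrightarrow>
        vdim (nat_region e) k = 0 \<longrightarrow> w * N - C \<le> real k" for N
    proof (cases "c0 \<le> N")
      case False
      then have "w * N \<le> w * c0" using w by (intro mult_left_mono) auto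
      then have "w * N - C \<le> real k" for k :: nat
        using C(3) of_nat_0_le_iff[of k, where 'a = real] of_nat_0_le_iff[of m, where 'a = real] by linarith
      then show ?thesis by (intro exI[of _ 0]) simp
    next
      case True
      obtain a where a: "a \<in> supp f" using f0 supp_eq_empty_iff by blast
      \<comment> \<open>As many factors \<open>f\<close> as fit while a triangle of size at least
        \<open>c0\<close> remains for a monomial; their product vanishes to order at least
        \<open>j * m\<close>, close to \<open>w * N\<close>.\<close>
      define j where "j = nat \<lfloor>(N - c0) / t\<rfloor>"
      have "0 \<le> (N - c0) / t" using True t by simp
      then have j: "real j \<le> (N - c0) / t" "(N - c0) / t < real j + 1"
        unfolding j_def by linarith+
      define c where "c = real j * real (fst a) + real j * real (snd a)"
      show ?thesis
      proof (intro exI[of _ c] conjI allI impI)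
        show "0 \<le> c" by (simp add: c_def)
        fix e k assume e: "size3 e = N" "\<forall>x\<in>region e. c \<le> x $ 1 \<and> c \<le> x $ 2"
          and z: "vdim (nat_region e) k = 0"
        let ?e = "\<lambda>i. e i - real j * tight f i"
        have size: "size3 ?e = N - real j * t"
          using e by (simp add: size3_diff size3_scale t_def tau_def)
        have "real j * t \<le> N - c0" using j(1) t by (simp add: pos_le_divide_eq)
        then have large: "3 * slack + 1 \<le> size3 ?e" using size by (simp add: c0_def)
        have "0 \<le> x $ 1 \<and> 0 \<le> x $ 2" if "x \<in> region ?e" for x
          using region_minus_margin[of e c f a x j] e f0 a that unfolding c_def
          by (smt (verit) mult_nonneg_nonneg of_nat_0_le_iff)
        then have "vol * (size3 ?e - 3 * slack)\<^sup>2 \<le> real (card (nat_region ?e))"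
          using large by (intro card_nat_region_ge) auto
        moreover have "0 < vol * (size3 ?e - 3 * slack)\<^sup>2"
          using vol_pos large by (intro mult_pos_pos zero_less_power) auto
        ultimately have "card (nat_region ?e) \<noteq> 0" by (metis less_le_not_le of_nat_0)
        then obtain a' where a': "a' \<in> nat_region ?e" by (metis card.empty ex_in_conv)
        have "mono2 a' \<in> vanishing_on (nat_region ?e) 0"
          using a' by (simp add: vanishing_on_def polys_on_def)
        then have g: "f ^ j * mono2 a' \<in> vanishing_on (nat_region e) (j * m)"
          using power_times_vanishing_on[OF f0 order_refl, of j e 0] by (auto simp: m_def)
        have "\<not> k \<le> j * m"
        proof
          assume "k \<le> j * m"
          then have "f ^ j * mono2 a' \<in> vanishing_on (nat_region e) k"
            using g by (auto simp: vanishing_on_def elim: vanishes_to_mono)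
          then have "f ^ j * mono2 a' = 0" using z vdim_eq_0_iff[OF finite_nat_region] by blast
          then show False using f0 by simp
        qed
        then have "j * m \<le> k" by simp
        then have "real (j * m) \<le> real k" by (simp only: of_nat_le_iff)
        moreover have "((N - c0) / t - 1) * real m \<le> real j * real m"
          using j(2) by (intro mult_right_mono) auto
        moreover have "((N - c0) / t - 1) * real m = w * N - w * c0 - real m"
          using t by (simp add: w_def field_simps)
        ultimately show "w * N - C \<le> real k" using C(3) by simp
      qed
    qed
  qed (use lam lw ratio in auto)
  then show thesis by (rule that)
qed

lemma thresholds_exist:
  obtains lam w C where "thresholds u v b lam w C"
proof (cases "\<exists>f. prime f \<and> real (mult_at_1 f) > sqrt (2 * vol) * tau f")
  case True
  then show thesis using thresholds_if_negative_curve that by blast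
next
  case False
  then have "thresholds u v b (sqrt (2 * vol)) (sqrt (2 * vol)) (3 * slack * sqrt (2 * vol) + 1)"
    by (intro thresholds_if_no_negative_curve) (metis not_less)
  then show thesis by (rule that)
qed

end

section \<open>The limits\<close>

context barycentric
begin

lemma dilate_region:
  assumes "d > 0"
  shows "x \<in> dilate d (region b) \<longleftrightarrow> (\<forall>i<3. - (d * b i) \<le> form i (coords x))"
proof -
  have scaled: "d *\<^sub>R y \<in> dilate d (region b) \<longleftrightarrow> (\<forall>i<3. - (d * b i) \<le> form i (coords (d *\<^sub>R y)))" for y
  proof -
    have "d *\<^sub>R y \<in> dilate d (region b) \<longleftrightarrow> y \<in> region b"
      using assms by (auto simp: dilate_def)
    also have "\<dots> \<longleftrightarrow> (\<forall>i<3. d * - b i \<le> d * form i (coords y))"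
      by (simp only: region_def mem_Collect_eq mult_le_cancel_left_pos[OF assms])
    finally show ?thesis by (simp add: coords_scaleR form_scaleR)
  qed
  have "x = d *\<^sub>R ((1 / d) *\<^sub>R x)" using assms by simp
  then show ?thesis using scaled by metis
qed

text \<open>Translation by \<open>(z, z)\<close> turns the lattice points of the dilate into
  exponents; \<open>pos\<close> guarantees that none is lost.\<close>

lemma lattice_model_dilate:
  assumes d: "d > 0" and pos: "\<And>x. x \<in> region (shifted d z) \<Longrightarrow> 0 \<le> x $ 1 \<and> 0 \<le> x $ 2"
  shows "lattice_model (dilate d (region b)) (real z, real z) (nat_region (shifted d z))"
proof
  have coords_pt: "coords (pt y) = y" for y by (simp add: coords_def)
  have in_dilate: "pt (lattice_at (real z, real z) a) \<in> dilate d (region b) \<longleftrightarrow> a \<in> nat_region (shifted d z)" for a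
  proof -
    have "form i (lattice_at (real z, real z) a) = nform i a - nform i (z, z)" for i
      by (simp add: lattice_at_def nform_def flip: form_diff)
    then have "- (d * b i) \<le> form i (lattice_at (real z, real z) a) \<longleftrightarrow> - shifted d z i \<le> nform i a" for i
      by (auto simp: shifted_def)
    then show ?thesis
      by (simp only: dilate_region[OF d] coords_pt nat_region_iff)
  qed
  show "finite (nat_region (shifted d z))" by simp
  show "lattice_points (dilate d (region b)) = (\<lambda>a. pt (lattice_at (real z, real z) a)) ` nat_region (shifted d z)"
  proof (intro equalityI subsetI)
    fix x assume x: "x \<in> lattice_points (dilate d (region b))"
    have "x + corner (z, z) \<in> region (shifted d z)"
      using x dilate_region[OF d, of x] unfolding lattice_points_def
      by (simp add: region_def coords_add form_add form_corner shifted_def)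
    then have nonneg: "0 \<le> x $ 1 + real z" "0 \<le> x $ 2 + real z" using pos by force+
    obtain k l where kl: "x $ 1 = of_int k" "x $ 2 = of_int l"
      using x by (auto simp: lattice_points_def elim!: Ints_cases) (metis Ints_cases)
    define a where "a = (nat (k + int z), nat (l + int z))"
    have "0 \<le> k + int z" "0 \<le> l + int z" using nonneg kl by linarith+
    then have "x = pt (lattice_at (real z, real z) a)"
      using kl by (simp add: vec_eq_iff all_2 lattice_at_def a_def)
    then show "x \<in> (\<lambda>a. pt (lattice_at (real z, real z) a)) ` nat_region (shifted d z)"
      using x in_dilate by (auto simp: lattice_points_def)
  next
    fix x assume "x \<in> (\<lambda>a. pt (lattice_at (real z, real z) a)) ` nat_region (shifted d z)"
    then show "x \<in> lattice_points (dilate d (region b))"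
      using in_dilate by (auto simp: lattice_points_def all_2 lattice_at_def)
  qed
qed

end

context thresholds
begin

lemma w_pos: "w > 0"
  using lam_pos lam_le_w by simp

text \<open>Twice the linear errors in \<open>degree_bounds\<close>: \<open>C\<close> from
  \<open>vdim_upper\<close>, \<open>6 * slack * vol\<close> from the lattice points and
  \<open>3 * lam / 2\<close> from the triangular number of \<open>k \<le> lam * d + 1\<close>. The
  constant errors are collected in \<open>R0\<close>.\<close>

definition R1 :: real where "R1 = 2 * C + 12 * slack * vol + 3 * lam"
definition R0 :: real where "R0 = 2 * C + 2"

lemma degree_bounds:
  assumes d: "d > 0"
  defines "r \<equiv> real (r_deg (dilate d (region b)))" and "s \<equiv> real (s_deg (dilate d (region b)))"
  shows "r - 1 \<le> lam * d" "s \<le> w * d" "w * d - C - 1 \<le> s"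
    and "3 * slack \<le> d \<Longrightarrow> lam * d - sqrt (R1 * d + R0) \<le> r"
proof -
  obtain c where c: "c \<ge> 0" "\<And>e k. size3 e = d \<Longrightarrow> (\<forall>x\<in>region e. c \<le> x $ 1 \<and> c \<le> x $ 2) \<Longrightarrow>
      vdim (nat_region e) k = 0 \<Longrightarrow> w * d - C \<le> real k"
    using vdim_zero[of d] by blast
  obtain z where z: "\<And>x. x \<in> region (shifted d z) \<Longrightarrow> c \<le> x $ 1 \<and> c \<le> x $ 2"
    using shifted_margin by blast
  then have pos: "0 \<le> x $ 1 \<and> 0 \<le> x $ 2" if "x \<in> region (shifted d z)" for x
    using c(1) that by force
  define e where "e = shifted d z"
  have size: "size3 e = d" by (simp add: e_def size3_shifted)
  interpret lattice_model "dilate d (region b)" "(real z, real z)" "nat_region e"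
    unfolding e_def by (rule lattice_model_dilate[OF d pos])
  show "r - 1 \<le> lam * d"
  proof (cases "r_deg (dilate d (region b)) = 0")
    case True
    moreover have "0 \<le> lam * d" using lam_pos d by simp
    ultimately show ?thesis by (simp add: r_def)
  next
    case False
    then show ?thesis
      using full_jets[OF vdim_add_le_card_if_le_r_deg[OF order_refl]] size by (simp add: r_def)
  qed
  define u0 where "u0 = nat \<lfloor>w * d\<rfloor>"
  have u0: "real u0 \<le> w * d" "w * d < real (u0 + 1)"
    unfolding u0_def using w_pos d by (simp_all add: less_imp_le; linarith)+
  have zero: "vdim (nat_region e) (u0 + 1) = 0"
    using u0 size w_pos by (intro vdim_eq_0_if_ratio[OF ratio]) simp_all
  show "s \<le> w * d"
    using s_deg_le[OF zero] u0 by (simp add: s_def)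
  \<comment> \<open>Interpolation in degree \<open>s\<close> concerns vanishing to order
    \<open>s + 1\<close>, hence the extra 1.\<close>
  show "w * d - C - 1 \<le> s"
    using c(2)[OF size _ vdim_s_deg[OF zero]] z by (simp add: e_def s_def)
  show "lam * d - sqrt (R1 * d + R0) \<le> r" if large: "3 * slack \<le> d"
  proof -
    \<comment> \<open>The first integer beyond \<open>lam * d\<close>, hence the smallest order to
      which \<open>vdim_upper\<close> applies.\<close>
    define k where "k = nat \<lfloor>lam * d\<rfloor> + 1"
    have k: "lam * d < real k" "real k \<le> lam * d + 1"
      unfolding k_def using lam_pos d by (simp_all add: less_imp_le; linarith)+
    have "vol * (d - 3 * slack)\<^sup>2 \<le> real (card (nat_region e))"
      using card_nat_region_ge[of e] size large pos by (simp add: e_def)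
    moreover have "vol * (d - 3 * slack)\<^sup>2 \<ge> vol * d\<^sup>2 - 6 * slack * vol * d"
      using vol_pos slack_nonneg by (simp add: power2_eq_square algebra_simps)
    ultimately have N: "vol * d\<^sup>2 - 6 * slack * vol * d \<le> real (card (nat_region e))" by simp
    have v: "real (vdim (nat_region e) k) \<le> lam * (w - lam) / 2 * d\<^sup>2 + C * d + C"
      using vdim_upper[of e k] size k d by simp
    show ?thesis
    proof (cases "r_deg (dilate d (region b)) \<le> k")
      case True
      have "real (card (nat_region e)) + real (card (deg_below (k - r_deg (dilate d (region b))))) \<le>
          real (vdim (nat_region e) k) + real (card (deg_below k))"
        using card_le_vdim_if_r_deg_le[OF True] by (metis of_nat_add of_nat_mono)
      moreover have "real (k - r_deg (dilate d (region b))) = real k - r"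
        using True by (simp add: r_def of_nat_diff)
      ultimately have main: "real (card (nat_region e)) + (real k - r) * (real k - r + 1) / 2 \<le>
          real (vdim (nat_region e) k) + real k * (real k + 1) / 2"
        by (simp add: card_deg_below_real)
      have "real k * (real k + 1) \<le> (lam * d + 1) * (lam * d + 1 + 1)"
        using k by (intro mult_mono) auto
      then have kk: "real k * (real k + 1) / 2 \<le> lam\<^sup>2 * d\<^sup>2 / 2 + 3 * lam * d / 2 + 1"
        by (simp add: power2_eq_square algebra_simps)
      have "(real k - r)\<^sup>2 \<le> (real k - r) * (real k - r + 1)"
        using True by (simp add: r_def power2_eq_square algebra_simps)
      then have "(real k - r)\<^sup>2 / 2 \<le> lam * (w - lam) / 2 * d\<^sup>2 + C * d + C +
          (lam\<^sup>2 * d\<^sup>2 / 2 + 3 * lam * d / 2 + 1) - (vol * d\<^sup>2 - 6 * slack * vol * d)"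
        using main N v kk by linarith
      \<comment> \<open>The quadratic terms cancel exactly because \<open>lam * w = 2 * vol\<close>;
        only errors linear in \<open>d\<close> survive.\<close>
      also have "\<dots> = (lam * w / 2 - vol) * d\<^sup>2 + (R1 * d + R0) / 2"
        by (simp add: R1_def R0_def power2_eq_square field_simps)
      also have "\<dots> = (R1 * d + R0) / 2" by (simp add: lam_w)
      finally have "(real k - r)\<^sup>2 \<le> R1 * d + R0" by simp
      then have "real k - r \<le> sqrt (R1 * d + R0)" by (rule real_le_rsqrt)
      then show ?thesis using k by simp
    next
      case False
      have "R1 * d + R0 \<ge> 0"
      proof -
        \<comment> \<open>The triangle of size zero in \<open>vdim_upper\<close> shows that
          \<open>C\<close> is nonnegative.\<close>
        have "0 \<le> lam * (w - lam) / 2 * 0\<^sup>2 + C * 0 + C"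
          using vdim_upper[of "\<lambda>_. 0" 1] by (simp add: size3_def)
        then show ?thesis
          using d lam_pos vol_pos slack_nonneg by (simp add: R1_def R0_def)
      qed
      then have "0 \<le> sqrt (R1 * d + R0)" by simp
      moreover have "real k \<le> r" using False by (simp add: r_def)
      ultimately show ?thesis using k(1) by linarith
    qed
  qed
qed

lemma r_deg_limit:
  "((\<lambda>d. (real (r_deg (dilate d (region b))) - 1) / d) \<longlongrightarrow> lam) at_top"
proof (rule tendsto_sandwich)
  show "((\<lambda>d. lam - sqrt (R1 * inverse d + R0 * (inverse d * inverse d)) - inverse d) \<longlongrightarrow> lam) at_top"
  proof -
    have i: "(inverse \<longlongrightarrow> (0::real)) at_top"
      by (rule tendsto_inverse_0_at_top) (rule filterlim_ident)
    have "((\<lambda>d. lam - sqrt (R1 * inverse d + R0 * (inverse d * inverse d)) - inverse d) \<longlongrightarrow>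
        lam - sqrt (R1 * 0 + R0 * (0 * 0)) - 0) at_top"
      by (intro tendsto_intros i)
    then show ?thesis by simp
  qed
  show "\<forall>\<^sub>F d in at_top. lam - sqrt (R1 * inverse d + R0 * (inverse d * inverse d)) - inverse d \<le>
      (real (r_deg (dilate d (region b))) - 1) / d"
    using eventually_gt_at_top[of 0] eventually_ge_at_top[of "3 * slack"]
  proof eventually_elim
    case (elim d)
    have "sqrt (R1 * inverse d + R0 * (inverse d * inverse d)) * d =
        sqrt ((R1 * inverse d + R0 * (inverse d * inverse d)) * (d * d))"
      using elim by (simp add: real_sqrt_mult)
    also have "(R1 * inverse d + R0 * (inverse d * inverse d)) * (d * d) =
        R1 * (inverse d * d) * d + R0 * ((inverse d * d) * (inverse d * d))"
      by (simp add: algebra_simps)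
    also have "inverse d * d = 1" using elim by simp
    finally have "sqrt (R1 * inverse d + R0 * (inverse d * inverse d)) * d = sqrt (R1 * d + R0)"
      by simp
    then have "(lam - sqrt (R1 * inverse d + R0 * (inverse d * inverse d)) - inverse d) * d =
        lam * d - sqrt (R1 * d + R0) - 1"
      using elim by (simp add: left_diff_distrib)
    also have "\<dots> \<le> real (r_deg (dilate d (region b))) - 1"
      using degree_bounds(4)[OF elim(1,2)] by simp
    finally show ?case using elim by (simp add: pos_le_divide_eq)
  qed
  show "\<forall>\<^sub>F d in at_top. (real (r_deg (dilate d (region b))) - 1) / d \<le> lam"
    using eventually_gt_at_top[of 0]
    by eventually_elim (simp add: pos_divide_le_eq degree_bounds(1))
qed (rule tendsto_const)

lemma s_deg_limit:
  "((\<lambda>d. real (s_deg (dilate d (region b))) / d) \<longlongrightarrow> w) at_top"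
proof (rule tendsto_sandwich)
  show "((\<lambda>d. w - (C + 1) * inverse d) \<longlongrightarrow> w) at_top"
  proof -
    have i: "(inverse \<longlongrightarrow> (0::real)) at_top"
      by (rule tendsto_inverse_0_at_top) (rule filterlim_ident)
    have "((\<lambda>d. w - (C + 1) * inverse d) \<longlongrightarrow> w - (C + 1) * 0) at_top"
      by (intro tendsto_intros i)
    then show ?thesis by simp
  qed
  show "\<forall>\<^sub>F d in at_top. w - (C + 1) * inverse d \<le> real (s_deg (dilate d (region b))) / d"
    using eventually_gt_at_top[of 0]
  proof eventually_elim
    case (elim d)
    have "(w - (C + 1) * inverse d) * d = w * d - (C + 1) * (inverse d * d)"
      by (simp only: left_diff_distrib mult.assoc)
    also have "\<dots> = w * d - C - 1" using elim by simp
    finally have "(w - (C + 1) * inverse d) * d = w * d - C - 1" .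
    then show ?case
      using degree_bounds(3)[OF elim] elim by (simp add: pos_le_divide_eq)
  qed
  show "\<forall>\<^sub>F d in at_top. real (s_deg (dilate d (region b))) / d \<le> w"
    using eventually_gt_at_top[of 0]
    by eventually_elim (simp add: pos_divide_le_eq degree_bounds(2))
qed (rule tendsto_const)

end

theorem mainTheorem3:
  fixes a b c :: "real ^ 2" and P :: "(real ^ 2) set"
  assumes "\<not> collinear {a, b, c}"
    and "P = convex hull {a, b, c}"
  shows "\<exists>v w :: real.
    ((\<lambda>d :: real. (real (r_deg (dilate d P)) - 1) / d) \<longlongrightarrow> v) at_top \<and>
    ((\<lambda>d :: real. real (s_deg (dilate d P)) / d) \<longlongrightarrow> w) at_top \<and>
    v > 0 \<and> w > 0 \<and>
    v * w = 2 * measure lebesgue P"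
proof -
  obtain \<alpha> \<beta> \<gamma> where bary: "barycentric \<alpha> \<beta> \<gamma>" and P: "P = barycentric.region \<alpha> \<beta> \<gamma>"
    using triangle_barycentric[OF assms(1)] assms(2) by metis
  obtain lam w C where "thresholds \<alpha> \<beta> \<gamma> lam w C"
    using barycentric.thresholds_exist[OF bary] by metis
  then interpret thresholds \<alpha> \<beta> \<gamma> lam w C .
  have "P = region \<gamma>" using P by simp
  then show ?thesis
    using r_deg_limit s_deg_limit lam_pos w_pos lam_w unfolding vol_def by blast
qed

end
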